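(* Consider the partial differential equation for $u=u(S,t)$, $S\in[0,\infty)$, $t\in[0,T]$, $$u_t+\frac{\sigma^2 S^2}{2}\,\frac{u_{SS}}{(1-\rho S\lambda(S)u_{SS})^2}=0 ,$$ where $\sigma$ (the volatility) and $\rho\neq0$ are constants and $\lambda(S)$ is a given function. With an arbitrary function $\lambda(S)$ the equation possesses a trivial three-dimensional Lie algebra $\mathcal{D}iff_\Delta(M)$ of infinitesimal Lie point symmetries, spanned by the generators $$V_1=\frac{\partial}{\partial t},\qquad V_2=S\frac{\partial}{\partial u},\qquad V_3=\frac{\partial}{\partial u}.$$ Only for the special form of the function $\lambda(S)\equiv\omega S^k$, where $\omega,k\in\mathbb{R}$, $\omega\neq0$, does the equation admit a nontrivial four-dimensional Lie algebra, spanned by the generators $$V_1=\frac{\partial}{\partial t},\qquad V_2=S\frac{\partial}{\partial u},\qquad V_3=\frac{\partial}{\partial u},\qquad V_4=S\frac{\partial}{\partial S}+(1-k)\,u\frac{\partial}{\partial u}.$$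
   Context: Let $M$ be the space with coordinates $(S,t,u)$ and let $M^{(2)}$ be the second order jet space with coordinates $w=(S,t,u,u_S,u_t,u_{SS},u_{St},u_{tt})$. Put $$\Delta(w)=u_t+\frac{\sigma^2S^2}{2}\frac{u_{SS}}{(1-\rho S\lambda(S)u_{SS})^2},\qquad L_\Delta=\{w\in M^{(2)}:\Delta(w)=0\}.$$ A vector field $$V=\xi(S,t,u)\frac{\partial}{\partial S}+\tau(S,t,u)\frac{\partial}{\partial t}+\phi(S,t,u)\frac{\partial}{\partial u}$$ on $M$ with smooth coefficients is an infinitesimal Lie point symmetry of the equation if its second prolongation $pr^{(2)}V$ (in the standard sense of Lie group analysis of differential equations) satisfies $pr^{(2)}V(\Delta)=0$ on $L_\Delta$. These vector fields form the Lie algebra $\mathcal{D}iff_\Delta(M)$.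
   Formalization: The volatility σ is assumed nonzero, and the claim that the symmetry algebra is exactly three-dimensional excludes λ ≡ 0, where the equation is linear and has an infinite-dimensional symmetry algebra (it admits u∂/∂u). *)

theory Defs
  imports "HOL-Analysis.Analysis" "HOL-Library.Function_Algebras"
begin

text \<open>Functions into a real vector space form a real vector space pointwise, so that
  \<open>span\<close>, \<open>subspace\<close> and \<open>dim\<close> from the library apply to spaces of vector fields.\<close>

instantiation "fun" :: (type, scaleR) scaleR
begin
definition scaleR_fun :: "real \<Rightarrow> ('a \<Rightarrow> 'b) \<Rightarrow> 'a \<Rightarrow> 'b"
  where "scaleR_fun c f = (\<lambda>x. c *\<^sub>R f x)"
instance ..
end

instance "fun" :: (type, real_vector) real_vector
  by standard (simp_all add: scaleR_fun_def fun_eq_iff scaleR_add_right scaleR_add_left)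

text \<open>Infinite differentiability on an open set: all iterated directional derivatives exist and
  are differentiable.\<close>

fun C_k_on :: "nat \<Rightarrow> ('a::real_normed_vector \<Rightarrow> 'b::real_normed_vector) \<Rightarrow> 'a set \<Rightarrow> bool" where
  "C_k_on 0 f U \<longleftrightarrow> continuous_on U f"
| "C_k_on (Suc n) f U \<longleftrightarrow>
     (\<forall>x\<in>U. f differentiable (at x)) \<and> (\<forall>v. C_k_on n (\<lambda>x. frechet_derivative f (at x) v) U)"

definition smooth_on :: "('a::real_normed_vector \<Rightarrow> 'b::real_normed_vector) \<Rightarrow> 'a set \<Rightarrow> bool"
  where "smooth_on f U \<longleftrightarrow> (\<forall>n. C_k_on n f U)"

text \<open>Points are \<open>(S, t, u)\<close>, first order jets \<open>(S, t, u, u_S, u_t)\<close> and second order jets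
  \<open>(S, t, u, u_S, u_t, u_SS, u_St, u_tt)\<close>. The underlying space is taken over the interior of
  \<open>[0, \<infinity>) \<times> [0, T]\<close>: at \<open>S = 0\<close> the functions \<open>\<omega> S^k\<close> need not even be defined.\<close>

type_synonym point = "real \<times> real \<times> real"
type_synonym jet1 = "real \<times> real \<times> real \<times> real \<times> real"
type_synonym jet2 = "real \<times> real \<times> real \<times> real \<times> real \<times> real \<times> real \<times> real"
type_synonym vfield = "point \<Rightarrow> point"

definition space_M :: "real \<Rightarrow> point set"
  where "space_M T = {(S, t, u). 0 < S \<and> 0 < t \<and> t < T}"

text \<open>A vector field is its coefficient triple \<open>(\<xi>, \<tau>, \<phi>)\<close>, set to \<open>0\<close> outside
  \<^term>\<open>space_M T\<close> so that equality of functions is equality of vector fields on that space.\<close>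

definition on_M :: "real \<Rightarrow> vfield \<Rightarrow> vfield"
  where "on_M T V = (\<lambda>p. if p \<in> space_M T then V p else 0)"

definition smooth_vfields :: "real \<Rightarrow> vfield set"
  where "smooth_vfields T = {V. smooth_on V (space_M T) \<and> (\<forall>p. p \<notin> space_M T \<longrightarrow> V p = 0)}"

definition lie_bracket :: "real \<Rightarrow> vfield \<Rightarrow> vfield \<Rightarrow> vfield"
  where "lie_bracket T V W =
    on_M T (\<lambda>p. frechet_derivative W (at p) (V p) - frechet_derivative V (at p) (W p))"

definition lie_algebra_vfields :: "real \<Rightarrow> vfield set \<Rightarrow> bool"
  where "lie_algebra_vfields T A \<longleftrightarrow>
    A \<subseteq> smooth_vfields T \<and> subspace A \<and> (\<forall>V\<in>A. \<forall>W\<in>A. lie_bracket T V W \<in> A)"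

definition xi_coeff :: "vfield \<Rightarrow> point \<Rightarrow> real" where "xi_coeff V p = fst (V p)"
definition tau_coeff :: "vfield \<Rightarrow> point \<Rightarrow> real" where "tau_coeff V p = fst (snd (V p))"
definition phi_coeff :: "vfield \<Rightarrow> point \<Rightarrow> real" where "phi_coeff V p = snd (snd (V p))"

text \<open>Total derivatives. For a function \<open>F\<close> on points, \<open>D_S F = F_S + u_S F_u\<close>; for a function
  \<open>G\<close> on first order jets, \<open>D_S G = G_S + u_S G_u + u_SS G_{u_S} + u_St G_{u_t}\<close>; likewise for
  \<open>D_t\<close>. The linear combination of partial derivatives is written as one directional derivative.\<close>

definition DS0 :: "(point \<Rightarrow> real) \<Rightarrow> jet1 \<Rightarrow> real"
  where "DS0 F = (\<lambda>(S, t, u, uS, ut). frechet_derivative F (at (S, t, u)) (1, 0, uS))"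

definition Dt0 :: "(point \<Rightarrow> real) \<Rightarrow> jet1 \<Rightarrow> real"
  where "Dt0 F = (\<lambda>(S, t, u, uS, ut). frechet_derivative F (at (S, t, u)) (0, 1, ut))"

definition DS1 :: "(jet1 \<Rightarrow> real) \<Rightarrow> jet2 \<Rightarrow> real"
  where "DS1 G = (\<lambda>(S, t, u, uS, ut, uSS, uSt, utt).
    frechet_derivative G (at (S, t, u, uS, ut)) (1, 0, uS, uSS, uSt))"

definition Dt1 :: "(jet1 \<Rightarrow> real) \<Rightarrow> jet2 \<Rightarrow> real"
  where "Dt1 G = (\<lambda>(S, t, u, uS, ut, uSS, uSt, utt).
    frechet_derivative G (at (S, t, u, uS, ut)) (0, 1, ut, uSt, utt))"

text \<open>Prolongation coefficients, by the standard recursion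
  \<open>\<phi>^{J,i} = D_i \<phi>^J - u_{J,S} D_i \<xi> - u_{J,t} D_i \<tau>\<close>.\<close>

definition phi_S :: "vfield \<Rightarrow> jet1 \<Rightarrow> real"
  where "phi_S V = (\<lambda>(S, t, u, uS, ut). let w = (S, t, u, uS, ut) in
    DS0 (phi_coeff V) w - uS * DS0 (xi_coeff V) w - ut * DS0 (tau_coeff V) w)"

definition phi_t :: "vfield \<Rightarrow> jet1 \<Rightarrow> real"
  where "phi_t V = (\<lambda>(S, t, u, uS, ut). let w = (S, t, u, uS, ut) in
    Dt0 (phi_coeff V) w - uS * Dt0 (xi_coeff V) w - ut * Dt0 (tau_coeff V) w)"

definition phi_SS :: "vfield \<Rightarrow> jet2 \<Rightarrow> real"
  where "phi_SS V = (\<lambda>(S, t, u, uS, ut, uSS, uSt, utt). let w = (S, t, u, uS, ut) in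
    DS1 (phi_S V) (S, t, u, uS, ut, uSS, uSt, utt)
      - uSS * DS0 (xi_coeff V) w - uSt * DS0 (tau_coeff V) w)"

definition phi_St :: "vfield \<Rightarrow> jet2 \<Rightarrow> real"
  where "phi_St V = (\<lambda>(S, t, u, uS, ut, uSS, uSt, utt). let w = (S, t, u, uS, ut) in
    Dt1 (phi_S V) (S, t, u, uS, ut, uSS, uSt, utt)
      - uSS * Dt0 (xi_coeff V) w - uSt * Dt0 (tau_coeff V) w)"

definition phi_tt :: "vfield \<Rightarrow> jet2 \<Rightarrow> real"
  where "phi_tt V = (\<lambda>(S, t, u, uS, ut, uSS, uSt, utt). let w = (S, t, u, uS, ut) in
    Dt1 (phi_t V) (S, t, u, uS, ut, uSS, uSt, utt)
      - uSt * Dt0 (xi_coeff V) w - utt * Dt0 (tau_coeff V) w)"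

definition pr2 :: "vfield \<Rightarrow> jet2 \<Rightarrow> jet2"
  where "pr2 V = (\<lambda>(S, t, u, uS, ut, uSS, uSt, utt).
    let p = (S, t, u); w1 = (S, t, u, uS, ut); w = (S, t, u, uS, ut, uSS, uSt, utt) in
    (xi_coeff V p, tau_coeff V p, phi_coeff V p, phi_S V w1, phi_t V w1,
     phi_SS V w, phi_St V w, phi_tt V w))"

text \<open>The vector field \<^term>\<open>pr2 V\<close> on jet space acting as a derivation on \<open>F\<close>.\<close>

definition pr2_apply :: "vfield \<Rightarrow> (jet2 \<Rightarrow> real) \<Rightarrow> jet2 \<Rightarrow> real"
  where "pr2_apply V F w = frechet_derivative F (at w) (pr2 V w)"

definition Delta :: "real \<Rightarrow> real \<Rightarrow> (real \<Rightarrow> real) \<Rightarrow> jet2 \<Rightarrow> real"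
  where "Delta \<sigma> \<rho> lam = (\<lambda>(S, t, u, uS, ut, uSS, uSt, utt).
    ut + \<sigma>\<^sup>2 * S\<^sup>2 / 2 * (uSS / (1 - \<rho> * S * lam S * uSS)\<^sup>2))"

text \<open>Jets at which the denominator of \<^const>\<open>Delta\<close> vanishes lie outside its domain; without the
  explicit condition they would enter through \<open>x / 0 = 0\<close>.\<close>

definition L_Delta :: "real \<Rightarrow> real \<Rightarrow> real \<Rightarrow> (real \<Rightarrow> real) \<Rightarrow> jet2 set"
  where "L_Delta T \<sigma> \<rho> lam = {(S, t, u, uS, ut, uSS, uSt, utt).
    (S, t, u) \<in> space_M T \<and> 1 - \<rho> * S * lam S * uSS \<noteq> 0 \<and>
    Delta \<sigma> \<rho> lam (S, t, u, uS, ut, uSS, uSt, utt) = 0}"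

definition Diff_Delta :: "real \<Rightarrow> real \<Rightarrow> real \<Rightarrow> (real \<Rightarrow> real) \<Rightarrow> vfield set"
  where "Diff_Delta T \<sigma> \<rho> lam = {V \<in> smooth_vfields T.
    \<forall>w \<in> L_Delta T \<sigma> \<rho> lam. pr2_apply V (Delta \<sigma> \<rho> lam) w = 0}"

definition V1 :: "real \<Rightarrow> vfield" where "V1 T = on_M T (\<lambda>(S, t, u). (0, 1, 0))"
definition V2 :: "real \<Rightarrow> vfield" where "V2 T = on_M T (\<lambda>(S, t, u). (0, 0, S))"
definition V3 :: "real \<Rightarrow> vfield" where "V3 T = on_M T (\<lambda>(S, t, u). (0, 0, 1))"
definition V4 :: "real \<Rightarrow> real \<Rightarrow> vfield"
  where "V4 T k = on_M T (\<lambda>(S, t, u). (S, 0, (1 - k) * u))"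

definition power_form :: "(real \<Rightarrow> real) \<Rightarrow> real \<Rightarrow> real \<Rightarrow> bool"
  where "power_form lam \<omega> k \<longleftrightarrow> \<omega> \<noteq> 0 \<and> (\<forall>S>0. lam S = \<omega> * S powr k)"

end

theory Submission
  imports Defs
begin

text \<open>Splitting the symmetry condition by the powers of \<open>u_St\<close>, \<open>u_S\<close> and \<open>u_SS\<close> gives the
  determining equations. Some of them hold only where \<open>lam \<noteq> 0\<close>, but their consequences
  \<open>\<xi> = \<alpha> S\<close>, \<open>\<tau> = \<beta>\<close>, \<open>\<phi> = \<gamma> u + \<psi>(S, t)\<close> propagate from a neighbourhood of one point with
  \<open>lam \<noteq> 0\<close> to the whole space, leaving the linear equation \<open>\<psi>_t + \<sigma>\<^sup>2 S\<^sup>2 / 2 \<psi>_SS = 0\<close>, where \<open>\<psi>\<close> is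
  affine in \<open>S\<close> near that point. As \<open>lam\<close> may vanish on an interval, that \<open>\<psi>\<close> is affine
  everywhere requires unique continuation from the line \<open>S = S0\<close>. The remaining equation is Euler's
  equation \<open>\<alpha> S lam' = (\<alpha> - \<gamma>) lam\<close>, which for \<open>\<alpha> \<noteq> 0\<close> forces a power of \<open>S\<close>.

  For unique continuation, integrate a solution of \<open>w_SS = g w_t\<close> against a bump
  \<open>((t - a) (b - t))^N / N!^2\<close>. Integration by parts turns \<open>2 N\<close> derivatives in \<open>S\<close> into \<open>N\<close>
  derivatives of the bump, so Taylor's formula bounds the integral by \<open>C K^N / (N! (2 N)!)\<close>, whereas
  it is at least \<open>c r^N / N!^2\<close> if \<open>w\<close> is bounded away from \<open>0\<close> on \<open>[a, b]\<close>.\<close>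

section \<open>Unique continuation\<close>

text \<open>The antiderivative \<open>?P\<close> of the bound dominates: \<open>?P - f\<close> and
  \<open>?P + f\<close> both have nonnegative derivative and vanish at 0.\<close>

lemma abs_le_power_if_deriv_le_aux:
  fixes f f' :: "real \<Rightarrow> real"
  assumes r: "0 \<le> r" and d: "\<And>y. 0 \<le> y \<Longrightarrow> y \<le> r \<Longrightarrow> (f has_real_derivative f' y) (at y)"
    and 0: "f 0 = 0" and b: "\<And>y. 0 \<le> y \<Longrightarrow> y \<le> r \<Longrightarrow> \<bar>f' y\<bar> \<le> A * y ^ m"
  shows "\<bar>f r\<bar> \<le> A * r ^ Suc m / Suc m"
proof -
  let ?P = "\<lambda>y. A * y ^ Suc m / real (Suc m)"
  have dP: "(?P has_real_derivative A * y ^ m) (at y)" for y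
    by (rule derivative_eq_intros refl | simp)+
  have "?P 0 - f 0 \<le> ?P r - f r"
  proof (rule DERIV_nonneg_imp_nondecreasing[OF r, of "\<lambda>y. ?P y - f y"])
    fix y assume y: "0 \<le> y" "y \<le> r"
    show "\<exists>z. ((\<lambda>y. ?P y - f y) has_real_derivative z) (at y) \<and> 0 \<le> z"
      using DERIV_diff[OF dP d[OF y]] b[OF y] by force
  qed
  moreover have "?P 0 + f 0 \<le> ?P r + f r"
  proof (rule DERIV_nonneg_imp_nondecreasing[OF r, of "\<lambda>y. ?P y + f y"])
    fix y assume y: "0 \<le> y" "y \<le> r"
    show "\<exists>z. ((\<lambda>y. ?P y + f y) has_real_derivative z) (at y) \<and> 0 \<le> z"
      using DERIV_add[OF dP d[OF y]] b[OF y] by force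
  qed
  ultimately show ?thesis using 0 by simp
qed

lemma abs_le_power_if_deriv_le:
  fixes f f' :: "real \<Rightarrow> real"
  assumes I: "convex I" "s0 \<in> I" "s \<in> I"
    and d: "\<And>x. x \<in> I \<Longrightarrow> (f has_real_derivative f' x) (at x)"
    and 0: "f s0 = 0" and b: "\<And>x. x \<in> I \<Longrightarrow> \<bar>f' x\<bar> \<le> A * \<bar>x - s0\<bar> ^ m"
  shows "\<bar>f s\<bar> \<le> A * \<bar>s - s0\<bar> ^ Suc m / Suc m"
proof -
  \<comment> \<open>The direction from \<open>s0\<close> to \<open>s\<close>. Along
    \<open>s0 + e * y\<close> the claim becomes the one-sided case with base point 0.\<close>
  define e where "e = (if s0 \<le> s then 1 else - 1 :: real)"
  have e: "\<bar>e\<bar> = 1" "s0 + e * \<bar>s - s0\<bar> = s" by (auto simp: e_def)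
  have mem: "s0 + e * y \<in> I" if "0 \<le> y" "y \<le> \<bar>s - s0\<bar>" for y
  proof -
    have "closed_segment s0 s \<subseteq> I" using I by (simp add: closed_segment_subset)
    moreover have "s0 + e * y \<in> closed_segment s0 s"
      using that by (auto simp: e_def closed_segment_eq_real_ivl split: if_splits)
    ultimately show ?thesis by blast
  qed
  have "\<bar>(\<lambda>y. f (s0 + e * y)) \<bar>s - s0\<bar>\<bar> \<le> A * \<bar>s - s0\<bar> ^ Suc m / Suc m"
  proof (rule abs_le_power_if_deriv_le_aux)
    fix y assume y: "0 \<le> y" "y \<le> \<bar>s - s0\<bar>"
    have "((\<lambda>y. s0 + e * y) has_real_derivative e) (at y)"
      by (rule derivative_eq_intros refl | simp)+
    from DERIV_chain2[OF d[OF mem[OF y]] this]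
    show "((\<lambda>y. f (s0 + e * y)) has_real_derivative f' (s0 + e * y) * e) (at y)" .
    show "\<bar>f' (s0 + e * y) * e\<bar> \<le> A * y ^ m"
      using b[OF mem[OF y]] e y by (simp add: abs_mult)
  qed (use 0 in auto)
  thus ?thesis using e by simp
qed

section \<open>Integrals against bump functions\<close>

text \<open>Dividing by factorials makes differentiation a pure index shift. Two indices are carried
  because each derivative splits a bump into two, lowering one index in each.\<close>

definition bump :: "real \<Rightarrow> real \<Rightarrow> nat \<Rightarrow> nat \<Rightarrow> real \<Rightarrow> real" where
  "bump a b i j t = (t - a) ^ i / fact i * ((b - t) ^ j / fact j)"

lemma bump_deriv:
  "(bump a b (Suc i) (Suc j) has_real_derivative bump a b i (Suc j) t - bump a b (Suc i) j t) (at t within X)"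
proof -
  have 1: "((\<lambda>t. (t - a) ^ Suc i / fact (Suc i)) has_real_derivative (t - a) ^ i / fact i) (at t within X)"
    by (rule derivative_eq_intros refl | simp del: of_nat_Suc fact_Suc)+ (simp add: fact_Suc del: of_nat_Suc)
  have 2: "((\<lambda>t. (b - t) ^ Suc j / fact (Suc j)) has_real_derivative - ((b - t) ^ j / fact j)) (at t within X)"
    by (rule derivative_eq_intros refl | simp del: of_nat_Suc fact_Suc)+ (simp add: fact_Suc del: of_nat_Suc)
  show ?thesis
    unfolding bump_def[abs_def]
    by (rule DERIV_cong[OF DERIV_mult[OF 1 2]]) (simp add: mult.commute del: power_Suc fact_Suc)
qed

lemma continuous_on_bump [continuous_intros]: "continuous_on X (bump a b i j)"
  unfolding bump_def[abs_def] by (intro continuous_intros) auto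

lemma bump_nonneg: "a \<le> t \<Longrightarrow> t \<le> b \<Longrightarrow> 0 \<le> bump a b i j t"
  by (simp add: bump_def)

text \<open>The binomial coefficient of \<open>i + j\<close> over \<open>i\<close> is at most
  \<open>2 ^ (i + j)\<close>, which trades the two factorials for a single one. All bumps of the
  same total degree thus share one bound.\<close>

lemma bump_le:
  assumes "a \<le> t" "t \<le> b"
  shows "bump a b i j t \<le> (2 * (b - a)) ^ (i + j) / fact (i + j)"
proof -
  have "(i + j) choose i \<le> 2 ^ (i + j)"
    using member_le_sum[of i "{..i+j}" "\<lambda>k. (i + j) choose k"] by (simp add: choose_row_sum)
  hence "real ((i + j) choose i) \<le> 2 ^ (i + j)"
    by (metis of_nat_le_iff of_nat_numeral of_nat_power)
  moreover have "real ((i + j) choose i) = fact (i + j) / (fact i * fact j)"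
    by (simp add: binomial_fact)
  ultimately have "1 / (fact i * fact j) \<le> (2::real) ^ (i + j) / fact (i + j)"
    by (simp add: field_simps)
  moreover have "(t - a) ^ i * (b - t) ^ j \<le> (b - a) ^ i * (b - a) ^ j"
    using assms by (intro mult_mono power_mono) auto
  moreover have "0 \<le> (t - a) ^ i * (b - t) ^ j" using assms by simp
  ultimately have "((t - a) ^ i * (b - t) ^ j) * (1 / (fact i * fact j)) \<le>
     ((b - a) ^ i * (b - a) ^ j) * (2 ^ (i + j) / fact (i + j))"
    by (meson mult_mono order_trans zero_le_divide_1_iff fact_ge_zero mult_nonneg_nonneg)
  moreover have "(b - a) ^ i * (b - a) ^ j * (2 ^ (i + j) / fact (i + j)) = (2 * (b - a)) ^ (i + j) / fact (i + j)"
    by (simp only: power_add power_mult_distrib times_divide_eq_right mult_ac)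
  ultimately show ?thesis by (simp add: bump_def)
qed


text \<open>Integration by parts. Both indices are positive, so the bump vanishes at both ends and
  no boundary term survives.\<close>

lemma bump_integral_step:
  fixes f f' :: "real \<Rightarrow> real"
  assumes ab: "a \<le> b"
    and d: "\<And>t. t \<in> {a..b} \<Longrightarrow> (f has_real_derivative f' t) (at t)"
    and c: "continuous_on {a..b} f'"
  shows "integral {a..b} (\<lambda>t. f' t * bump a b (Suc i) (Suc j) t) =
    integral {a..b} (\<lambda>t. f t * bump a b (Suc i) j t) - integral {a..b} (\<lambda>t. f t * bump a b i (Suc j) t)"
proof -
  have cf: "continuous_on {a..b} f"
    using d by (meson DERIV_isCont continuous_at_imp_continuous_on)
  have "((\<lambda>t. f' t * bump a b (Suc i) (Suc j) t + f t * (bump a b i (Suc j) t - bump a b (Suc i) j t))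
      has_integral f b * bump a b (Suc i) (Suc j) b - f a * bump a b (Suc i) (Suc j) a) {a..b}"
  proof (rule fundamental_theorem_of_calculus[OF ab])
    fix t assume t: "t \<in> {a..b}"
    show "((\<lambda>t. f t * bump a b (Suc i) (Suc j) t) has_vector_derivative
       f' t * bump a b (Suc i) (Suc j) t + f t * (bump a b i (Suc j) t - bump a b (Suc i) j t))
       (at t within {a..b})"
      using DERIV_mult[OF DERIV_subset[OF d[OF t], of "{a..b}"] bump_deriv[of a b i j t "{a..b}"]]
      by (simp add: has_real_derivative_iff_has_vector_derivative algebra_simps)
  qed
  moreover have "bump a b (Suc i) (Suc j) b = 0" "bump a b (Suc i) (Suc j) a = 0"
    by (simp_all add: bump_def)
  ultimately have "integral {a..b} (\<lambda>t. f' t * bump a b (Suc i) (Suc j) t +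
      (f t * bump a b i (Suc j) t - f t * bump a b (Suc i) j t)) = 0"
    by (simp add: integral_unique right_diff_distrib)
  moreover have "integral {a..b} (\<lambda>t. f' t * bump a b (Suc i) (Suc j) t +
      (f t * bump a b i (Suc j) t - f t * bump a b (Suc i) j t)) =
     integral {a..b} (\<lambda>t. f' t * bump a b (Suc i) (Suc j) t) +
      (integral {a..b} (\<lambda>t. f t * bump a b i (Suc j) t) - integral {a..b} (\<lambda>t. f t * bump a b (Suc i) j t))"
    by (subst integral_add integral_diff;
        (intro integrable_continuous_real continuous_intros c cf)?)+ simp
  ultimately show ?thesis by simp
qed

text \<open>Only the middle half of the interval is kept: there \<open>t - a\<close> and
  \<open>b - t\<close> are at least \<open>(b - a) / 4\<close>, and the rest contributes a
  nonnegative amount.\<close>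

lemma bump_integral_lower:
  assumes ab: "a < b" and c: "continuous_on {a..b} f" and m: "\<And>t. t \<in> {a..b} \<Longrightarrow> d \<le> f t" and d: "0 < (d::real)"
  shows "d * ((b - a) / 2) * (((b - a) / 4)\<^sup>2) ^ N / (fact N)\<^sup>2 \<le> integral {a..b} (\<lambda>t. f t * bump a b N N t)"
proof -
  define p where "p = a + (b - a) / 4"
  define q where "q = b - (b - a) / 4"
  have pq: "p \<le> q" "{p..q} \<subseteq> {a..b}" "q - p = (b - a) / 2" using ab by (auto simp: p_def q_def field_simps)
  have "d * ((b - a) / 2) * (((b - a) / 4)\<^sup>2) ^ N / (fact N)\<^sup>2 =
      integral {p..q} (\<lambda>t. d * ((((b - a) / 4)\<^sup>2) ^ N / (fact N)\<^sup>2))"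
    using pq(1) by (simp add: pq(3))
  also have "\<dots> \<le> integral {p..q} (\<lambda>t. f t * bump a b N N t)"
  proof (rule integral_le)
    fix t assume t: "t \<in> {p..q}"
    have "((b - a) / 4) ^ N \<le> (t - a) ^ N" "((b - a) / 4) ^ N \<le> (b - t) ^ N"
      using t ab by (intro power_mono; simp add: p_def q_def field_simps)+
    hence "((b - a) / 4) ^ N * ((b - a) / 4) ^ N \<le> (t - a) ^ N * (b - t) ^ N"
      using ab t pq(2) by (intro mult_mono) auto
    hence "((b - a) / 4) ^ N * ((b - a) / 4) ^ N / (fact N * fact N) \<le> (t - a) ^ N * (b - t) ^ N / (fact N * fact N)"
      by (rule divide_right_mono) simp
    hence "(((b - a) / 4)\<^sup>2) ^ N / (fact N)\<^sup>2 \<le> bump a b N N t"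
      unfolding bump_def by (simp only: power2_eq_square power_mult_distrib times_divide_times_eq[of _ "fact N"])
    thus "d * ((((b - a) / 4)\<^sup>2) ^ N / (fact N)\<^sup>2) \<le> f t * bump a b N N t"
      using m[of t] t pq d by (intro mult_mono) auto
  qed (intro integrable_continuous_real continuous_intros continuous_on_subset[OF c] pq)+
  also have "\<dots> \<le> integral {a..b} (\<lambda>t. f t * bump a b N N t)"
  proof (rule integral_subset_le)
    show "\<forall>t\<in>{a..b}. 0 \<le> f t * bump a b N N t"
    proof
      fix t assume t: "t \<in> {a..b}"
      show "0 \<le> f t * bump a b N N t"
        using m[OF t] d t by (intro mult_nonneg_nonneg bump_nonneg) auto
    qed
  qed (intro integrable_continuous_real continuous_intros continuous_on_subset[OF c] pq order_refl)+
  finally show ?thesis .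
qed

text \<open>A Cauchy problem in the direction of \<open>s\<close>, with zero data on the line
  \<open>s = s0\<close>. Moments in \<open>t\<close> against bumps turn the equation into a
  recursion in \<open>s\<close> in which repeated \<open>t\<close> derivatives fall on the
  bump.\<close>

theorem unique_continuation:
  fixes w ws wss wt :: "real \<Rightarrow> real \<Rightarrow> real"
  assumes I: "convex I" "open I" "s0 \<in> I" and J: "open J"
    and ds: "\<And>s t. s \<in> I \<Longrightarrow> t \<in> J \<Longrightarrow> ((\<lambda>s. w s t) has_real_derivative ws s t) (at s)"
    and dss: "\<And>s t. s \<in> I \<Longrightarrow> t \<in> J \<Longrightarrow> ((\<lambda>s. ws s t) has_real_derivative wss s t) (at s)"
    and dt: "\<And>s t. s \<in> I \<Longrightarrow> t \<in> J \<Longrightarrow> (w s has_real_derivative wt s t) (at t)"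
    and cw: "continuous_on (I \<times> J) (\<lambda>(s, t). w s t)"
    and cs: "continuous_on (I \<times> J) (\<lambda>(s, t). ws s t)"
    and css: "continuous_on (I \<times> J) (\<lambda>(s, t). wss s t)"
    and ct: "continuous_on (I \<times> J) (\<lambda>(s, t). wt s t)"
    and g: "continuous_on I g"
    and eq: "\<And>s t. s \<in> I \<Longrightarrow> t \<in> J \<Longrightarrow> wss s t = g s * wt s t"
    and zero: "\<And>t. t \<in> J \<Longrightarrow> w s0 t = 0" "\<And>t. t \<in> J \<Longrightarrow> ws s0 t = 0"
    and st: "s1 \<in> I" "t1 \<in> J"
  shows "w s1 t1 = 0"
proof (rule ccontr)
  assume nz: "w s1 t1 \<noteq> 0"
  \<comment> \<open>With the sign \<open>e\<close>, the value of \<open>e * w s1\<close> at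
    \<open>t1\<close> is \<open>2 * d\<close>, so it stays above \<open>d\<close> near
    \<open>t1\<close>.\<close>
  define e where "e = sgn (w s1 t1)"
  define d where "d = \<bar>w s1 t1\<bar> / 2"
  have d: "d > 0" and e: "\<bar>e\<bar> = 1" using nz by (auto simp: d_def e_def abs_sgn_eq)
  have "isCont (\<lambda>t. e * w s1 t) t1"
    using DERIV_isCont[OF dt[OF st]] by (intro continuous_intros)
  moreover have "e * w s1 t1 > d" using nz by (auto simp: e_def d_def sgn_if)
  ultimately have "eventually (\<lambda>t. e * w s1 t > d) (at t1)"
    unfolding isCont_def by (simp add: order_tendsto_iff)
  moreover have "eventually (\<lambda>t. t \<in> J) (at t1)"
    using eventually_at_topological J st(2) by blast
  ultimately have "eventually (\<lambda>t. e * w s1 t > d \<and> t \<in> J) (at t1)"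
    by eventually_elim simp
  then obtain \<delta> where \<delta>: "\<delta> > 0" "\<And>t. t \<noteq> t1 \<Longrightarrow> dist t t1 < \<delta> \<Longrightarrow> e * w s1 t > d \<and> t \<in> J"
    unfolding eventually_at by blast
  \<comment> \<open>The neighbourhood given by \<open>eventually_at\<close> is punctured, so the
    interval is placed strictly to the right of \<open>t1\<close>.\<close>
  define a where "a = t1 + \<delta> / 3"
  define b where "b = t1 + \<delta> / 2"
  have ab: "a < b" using \<delta> by (simp add: a_def b_def)
  have "t \<noteq> t1" "dist t t1 < \<delta>" if "t \<in> {a..b}" for t
    using that \<delta>(1) by (auto simp: a_def b_def dist_real_def)
  hence abJ: "{a..b} \<subseteq> J" and low: "\<And>t. t \<in> {a..b} \<Longrightarrow> d \<le> e * w s1 t"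
    using \<delta>(2) by (auto simp: less_imp_le)
  \<comment> \<open>The compact segment from \<open>s0\<close> to \<open>s1\<close> supplies uniform
    bounds for \<open>g\<close> and, over \<open>{a..b}\<close>, for \<open>w\<close>.\<close>
  define K where "K = closed_segment s0 s1"
  have K: "convex K" "compact K" "K \<subseteq> I" "s0 \<in> K" "s1 \<in> K"
    using I st by (auto simp: K_def closed_segment_subset)
  obtain G where G: "\<And>s. s \<in> K \<Longrightarrow> \<bar>g s\<bar> \<le> G"
    using compact_imp_bounded[OF compact_continuous_image[OF continuous_on_subset[OF g K(3)] K(2)]]
    by (auto simp: bounded_iff)
  have G0: "0 \<le> G" using G[OF K(4)] by simp
  have "K \<times> {a..b} \<subseteq> I \<times> J" using K(3) abJ by blast
  then obtain M where M: "\<And>s t. s \<in> K \<Longrightarrow> t \<in> {a..b} \<Longrightarrow> \<bar>w s t\<bar> \<le> M"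
    using compact_imp_bounded[OF compact_continuous_image[OF continuous_on_subset[OF cw]
        compact_Times[OF K(2) compact_Icc]], of a b]
    by (fastforce simp: bounded_iff)
  have M0: "0 \<le> M" using M[OF K(4), of a] ab by simp
  have sect: "continuous_on {a..b} (f s)" if "continuous_on (I \<times> J) (\<lambda>(s, t). f s t)" "s \<in> I" 
    for f :: "real \<Rightarrow> real \<Rightarrow> real" and s
    using continuous_on_compose2[OF that(1)
        continuous_on_Pair[OF continuous_on_const[of _ s] continuous_on_id[of "{a..b}"]]] that(2) abJ
    by auto
  have leib: "((\<lambda>s. integral {a..b} (\<lambda>t. f s t * bump a b i j t)) has_real_derivative
      integral {a..b} (\<lambda>t. f' s t * bump a b i j t)) (at s)"
    if f: "\<And>s t. s \<in> I \<Longrightarrow> t \<in> J \<Longrightarrow> ((\<lambda>s. f s t) has_real_derivative f' s t) (at s)"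
      and c: "continuous_on (I \<times> J) (\<lambda>(s, t). f s t)"
      and c': "continuous_on (I \<times> J) (\<lambda>(s, t). f' s t)" and s: "s \<in> I"
    for f f' :: "real \<Rightarrow> real \<Rightarrow> real" and s i j
  proof -
    have "((\<lambda>s. integral (cbox a b) (\<lambda>t. f s t * bump a b i j t)) has_real_derivative
      integral (cbox a b) (\<lambda>t. f' s t * bump a b i j t)) (at s within I)"
    proof (rule leibniz_rule_field_derivative[OF _ _ _ s I(1)])
      fix x t assume x: "x \<in> I" "t \<in> cbox a b"
      show "((\<lambda>x. f x t * bump a b i j t) has_real_derivative f' x t * bump a b i j t) (at x within I)"
        using x abJ by (intro DERIV_cmult_right DERIV_subset[OF f]) auto
    next
      fix x assume "x \<in> I"
      thus "(\<lambda>t. f x t * bump a b i j t) integrable_on cbox a b"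
        unfolding box_real by (intro integrable_continuous_real continuous_intros sect[OF c])
    next
      have "continuous_on (I \<times> {a..b}) (\<lambda>p. (case p of (s, t) \<Rightarrow> f' s t) * bump a b i j (snd p))"
        using abJ by (intro continuous_on_mult continuous_on_subset[OF c']
          continuous_on_compose2[OF continuous_on_bump[of UNIV]] continuous_on_snd continuous_on_id) auto
      thus "continuous_on (I \<times> cbox a b) (\<lambda>(x, t). f' x t * bump a b i j t)"
        by (simp add: case_prod_unfold)
    qed
    thus ?thesis by (simp only: at_within_open[OF s I(2)] box_real)
  qed
  \<comment> \<open>The moments of \<open>w\<close>, \<open>ws\<close> and \<open>wss\<close>. By
    \<open>leib\<close> each is the derivative in \<open>s\<close> of the preceding one.\<close>
  define E where "E i j s = integral {a..b} (\<lambda>t. w s t * bump a b i j t)" for i j s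
  define E1 where "E1 i j s = integral {a..b} (\<lambda>t. ws s t * bump a b i j t)" for i j s
  define E2 where "E2 i j s = integral {a..b} (\<lambda>t. wss s t * bump a b i j t)" for i j s
  have dE: "(E i j has_real_derivative E1 i j s) (at s)" if "s \<in> I" for i j s
    unfolding E_def E1_def by (rule leib[OF ds cw cs that])
  have dE1: "(E1 i j has_real_derivative E2 i j s) (at s)" if "s \<in> I" for i j s
    unfolding E1_def E2_def by (rule leib[OF dss cs css that])
  \<comment> \<open>Here the differential equation enters: \<open>wss\<close> becomes
    \<open>g * wt\<close>, and integration by parts replaces \<open>wt\<close> by \<open>w\<close>
    at the price of one bump index.\<close>
  have E2: "E2 (Suc i) (Suc j) s = g s * (E (Suc i) j s - E i (Suc j) s)" if s: "s \<in> I" for i j s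
  proof -
    have "E2 (Suc i) (Suc j) s = integral {a..b} (\<lambda>t. g s * (wt s t * bump a b (Suc i) (Suc j) t))"
      unfolding E2_def using eq[OF s] abJ by (intro Henstock_Kurzweil_Integration.integral_cong) auto
    also have "\<dots> = g s * integral {a..b} (\<lambda>t. wt s t * bump a b (Suc i) (Suc j) t)"
      by simp
    also have "integral {a..b} (\<lambda>t. wt s t * bump a b (Suc i) (Suc j) t) = E (Suc i) j s - E i (Suc j) s"
      unfolding E_def using ab dt[OF s] sect[OF ct s] abJ by (intro bump_integral_step) auto
    finally show ?thesis .
  qed
  have E0: "E i j s0 = 0" "E1 i j s0 = 0" for i j
  proof -
    have "E i j s0 = integral {a..b} (\<lambda>_. 0)" "E1 i j s0 = integral {a..b} (\<lambda>_. 0)"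
      unfolding E_def E1_def using zero abJ by (intro Henstock_Kurzweil_Integration.integral_cong; force)+
    thus "E i j s0 = 0" "E1 i j s0 = 0" by simp_all
  qed
  define Q where "Q m = M * (b - a) * ((2 * (b - a)) ^ m / fact m)" for m :: nat
  have Q0: "0 \<le> Q m" for m using M0 ab by (simp add: Q_def)
  have base: "\<bar>E i j s\<bar> \<le> Q (i + j)" if s: "s \<in> K" for i j s
  proof -
    have "norm (E i j s) \<le> integral {a..b} (\<lambda>t. M * ((2 * (b - a)) ^ (i + j) / fact (i + j)))"
      unfolding E_def
    proof (rule integral_norm_bound_integral)
      fix t assume t: "t \<in> {a..b}"
      show "norm (w s t * bump a b i j t) \<le> M * ((2 * (b - a)) ^ (i + j) / fact (i + j))"
        unfolding real_norm_def abs_mult using mult_mono[OF M[OF s t] bump_le[of a t b i j]]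
          bump_nonneg[of a t b i j] t M0 by simp
    next
      show "(\<lambda>t. w s t * bump a b i j t) integrable_on {a..b}"
        using s K(3) by (intro integrable_continuous_real continuous_intros sect[OF cw]) auto
    qed (intro integrable_continuous_real continuous_intros)
    thus ?thesis using ab by (simp add: Q_def mult_ac)
  qed
  \<comment> \<open>Each round integrates twice in \<open>s\<close> from the zero data at
    \<open>s0\<close>. It contributes a factor \<open>2 * G\<close> for the two terms weighted by
    \<open>g\<close>, lowers the total degree by one, and its two denominators extend
    \<open>fact (2 * n)\<close> to \<open>fact (2 * Suc n)\<close>.\<close>
  have main: "\<bar>E i j s\<bar> \<le> ((2 * G) ^ n * Q (i + j - n) / fact (2 * n)) * \<bar>s - s0\<bar> ^ (2 * n)"
    if "s \<in> K" "n \<le> i" "n \<le> j" for n i j s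
    using that
  proof (induction n arbitrary: i j s)
    case 0
    thus ?case using base by simp
  next
    case (Suc n)
    obtain i' j' where ij: "i = Suc i'" "j = Suc j'" "n \<le> i'" "n \<le> j'"
      using Suc.prems by (metis Suc_le_D Suc_le_mono)
    define R where "R = (2 * G) ^ n * Q (i + j - Suc n) / fact (2 * n)"
    have b2: "\<bar>E2 i j x\<bar> \<le> (2 * G * R) * \<bar>x - s0\<bar> ^ (2 * n)" if x: "x \<in> K" for x
    proof -
      have "\<bar>E i j' x\<bar> \<le> R * \<bar>x - s0\<bar> ^ (2 * n)" "\<bar>E i' j x\<bar> \<le> R * \<bar>x - s0\<bar> ^ (2 * n)"
        using Suc.IH[OF x, of i j'] Suc.IH[OF x, of i' j] ij by (simp_all add: R_def)
      hence "\<bar>E i j' x - E i' j x\<bar> \<le> 2 * (R * \<bar>x - s0\<bar> ^ (2 * n))" by linarith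
      hence "\<bar>g x\<bar> * \<bar>E i j' x - E i' j x\<bar> \<le> G * (2 * (R * \<bar>x - s0\<bar> ^ (2 * n)))"
        using G[OF x] G0 by (intro mult_mono) auto
      thus ?thesis using E2[of x i' j'] x K(3) ij by (auto simp: abs_mult mult_ac)
    qed
    have "\<bar>E1 i j x\<bar> \<le> 2 * G * R * \<bar>x - s0\<bar> ^ Suc (2 * n) / Suc (2 * n)" if x: "x \<in> K" for x
      by (rule abs_le_power_if_deriv_le[OF K(1,4) x dE1 E0(2) b2]) (use K(3) in auto)
    hence b1: "\<bar>E1 i j x\<bar> \<le> (2 * G * R / Suc (2 * n)) * \<bar>x - s0\<bar> ^ Suc (2 * n)" if x: "x \<in> K" for x
      using x by simp
    have "\<bar>E i j s\<bar> \<le> (2 * G * R / Suc (2 * n)) * \<bar>s - s0\<bar> ^ Suc (Suc (2 * n)) / Suc (Suc (2 * n))"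
      by (rule abs_le_power_if_deriv_le[OF K(1,4) Suc.prems(1) dE E0(1) b1]) (use K(3) in auto)
    also have "\<dots> = ((2 * G) ^ Suc n * Q (i + j - Suc n) / fact (2 * Suc n)) * \<bar>s - s0\<bar> ^ (2 * Suc n)"
      by (simp add: R_def fact_Suc mult_ac del: of_nat_Suc)
    finally show ?case .
  qed
  define r where "r = ((b - a) / 4)\<^sup>2"
  define c where "c = d * ((b - a) / 2)"
  define c' where "c' = M * (b - a)"
  define X where "X = 2 * G * (2 * (b - a)) * \<bar>s1 - s0\<bar>\<^sup>2"
  have pos: "r > 0" "c > 0" "c' \<ge> 0" "X \<ge> 0" using ab d M0 G0 by (auto simp: r_def c_def c'_def X_def)
  \<comment> \<open>With \<open>i = j = N\<close> there is room for \<open>N\<close> rounds. Even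
    after \<open>fact (2 * N)\<close> is weakened to \<open>(fact N)\<^sup>2\<close>, the upper
    bound keeps one factor \<open>1 / fact N\<close> more than the lower bound, and this beats the
    geometric factor \<open>(X / r) ^ N\<close>.\<close>
  have key: "c \<le> c' * (inverse (fact N) * (X / r) ^ N)" for N
  proof -
    have "c * r ^ N / (fact N)\<^sup>2 \<le> integral {a..b} (\<lambda>t. (e * w s1 t) * bump a b N N t)"
      unfolding c_def r_def using sect[OF cw st(1)]
      by (intro bump_integral_lower[OF ab _ low d] continuous_intros) auto
    also have "\<dots> = e * E N N s1" by (simp add: E_def mult.assoc)
    also have "\<dots> \<le> \<bar>E N N s1\<bar>" using e by (metis abs_ge_self abs_mult mult_1)
    also have "\<dots> \<le> ((2 * G) ^ N * Q N / fact (2 * N)) * \<bar>s1 - s0\<bar> ^ (2 * N)"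
      using main[OF K(5), of N N N] by simp
    also have "\<dots> = c' * X ^ N / (fact N * fact (2 * N))"
      by (simp add: Q_def c'_def X_def power_mult power_mult_distrib)
    also have "\<dots> \<le> c' * X ^ N / (fact N * (fact N * fact N))"
    proof -
      have "fact N * fact N \<le> (fact (2 * N) :: nat)"
        using dvd_imp_le[OF fact_fact_dvd_fact[of N N]] by (simp add: mult_2)
      hence "fact N * fact N \<le> (fact (2 * N) :: real)"
        by (metis of_nat_fact of_nat_le_iff of_nat_mult)
      thus ?thesis using pos by (intro divide_left_mono mult_left_mono) auto
    qed
    finally show ?thesis using pos by (simp add: field_simps power2_eq_square)
  qed
  have "(\<lambda>N. c' * (inverse (fact N) * (X / r) ^ N)) \<longlonglongrightarrow> c' * 0"
    by (intro tendsto_mult_left summable_LIMSEQ_zero summable_exp)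
  hence "c \<le> c' * 0"
    by (rule LIMSEQ_le_const) (use key in blast)
  with pos show False by simp
qed

section \<open>Smooth functions and prolongations\<close>

text \<open>\<open>frechet_derivative\<close> chooses a map related to the function by
  \<open>has_derivative\<close>. Near \<open>x\<close> both functions satisfy this relation for the
  same maps, so the two choices agree, also where no derivative exists.\<close>

lemma frechet_derivative_cong_open:
  assumes "open U" "x \<in> U" "\<And>y. y \<in> U \<Longrightarrow> f y = g y"
  shows "frechet_derivative f (at x) = frechet_derivative g (at x)"
proof -
  have "(f has_derivative D) (at x) \<longleftrightarrow> (g has_derivative D) (at x)" for D
    using has_derivative_transform_within_open[of f D x UNIV U g]
      has_derivative_transform_within_open[of g D x UNIV U f] assms by auto
  thus ?thesis by (simp add: frechet_derivative_def)
qed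

lemma differentiable_cong_open:
  assumes "open U" "x \<in> U" "\<And>y. y \<in> U \<Longrightarrow> f y = g y" "f differentiable (at x)"
  shows "g differentiable (at x)"
proof -
  obtain D where "(f has_derivative D) (at x)"
    using assms(4) by (auto simp: differentiable_def)
  hence "(g has_derivative D) (at x)"
    using has_derivative_transform_within_open assms(1-3) by blast
  thus ?thesis by (auto simp: differentiable_def)
qed

lemma C_k_on_cong:
  assumes "open U" "\<And>x. x \<in> U \<Longrightarrow> f x = g x" "C_k_on n f U"
  shows "C_k_on n g U"
  using assms
proof (induction n arbitrary: f g)
  case 0
  thus ?case using continuous_on_cong by force
next
  case (Suc n)
  have "C_k_on n (\<lambda>x. frechet_derivative g (at x) v) U" for v
    using Suc.prems Suc.IH[of "\<lambda>x. frechet_derivative f (at x) v"]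
      frechet_derivative_cong_open[OF Suc.prems(1) _ Suc.prems(2)] by simp
  moreover have "\<forall>x\<in>U. g differentiable (at x)"
    using Suc.prems differentiable_cong_open by (metis C_k_on.simps(2))
  ultimately show ?case by simp
qed

lemma C_k_on_const: "open U \<Longrightarrow> C_k_on n (\<lambda>x. c) U"
  by (induction n arbitrary: c) (auto simp: continuous_on_const)

text \<open>Applied to projections, this passes from a smooth vector field to its
  coefficients.\<close>

lemma C_k_on_bounded_linear_comp:
  assumes "open U" "bounded_linear L" "C_k_on n f U"
  shows "C_k_on n (\<lambda>x. L (f x)) U"
  using assms(3)
proof (induction n arbitrary: f)
  case 0
  thus ?case using bounded_linear.continuous_on[OF assms(2)] by simp
next
  case (Suc n)
  have der: "((\<lambda>x. L (f x)) has_derivative (\<lambda>v. L (frechet_derivative f (at x) v))) (at x)" if "x \<in> U" for x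
    using Suc.prems that
    by (intro bounded_linear.has_derivative[OF assms(2)] iffD1[OF frechet_derivative_works]) simp
  have "C_k_on n (\<lambda>x. frechet_derivative (\<lambda>x. L (f x)) (at x) v) U" for v
  proof (rule C_k_on_cong[OF assms(1)])
    show "C_k_on n (\<lambda>x. L (frechet_derivative f (at x) v)) U"
      using Suc by simp
    show "L (frechet_derivative f (at x) v) = frechet_derivative (\<lambda>x. L (f x)) (at x) v" if "x \<in> U" for x
      by (simp add: frechet_derivative_at[OF der[OF that], symmetric])
  qed
  moreover have "\<forall>x\<in>U. (\<lambda>x. L (f x)) differentiable (at x)"
    using der unfolding differentiable_def by blast
  ultimately show ?case by simp
qed

lemma smooth_on_affine:
  assumes "open U" "bounded_linear L" "\<And>x. x \<in> U \<Longrightarrow> f x = L x + c"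
  shows "smooth_on f U"
  unfolding smooth_on_def
proof
  fix n
  have der: "((\<lambda>x. L x + c) has_derivative L) (at x)" for x
    using bounded_linear.has_derivative[OF assms(2) has_derivative_ident]
    by (auto intro!: derivative_eq_intros)
  hence "frechet_derivative (\<lambda>x. L x + c) (at x) = L" for x
    by (rule frechet_derivative_at[symmetric])
  moreover have "continuous_on U (\<lambda>x. L x + c)"
    using der by (meson continuous_at_imp_continuous_on has_derivative_continuous)
  ultimately have "C_k_on n (\<lambda>x. L x + c) U"
    using der C_k_on_const[OF assms(1)] by (cases n) (auto simp: differentiable_def)
  thus "C_k_on n f U"
    using C_k_on_cong[OF assms(1), of "\<lambda>x. L x + c" f] assms(3) by simp
qed

lemma smooth_onD:
  assumes "smooth_on f U"
  shows "continuous_on U f" "x \<in> U \<Longrightarrow> f differentiable (at x)"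
    "smooth_on (\<lambda>x. frechet_derivative f (at x) v) U"
  using assms C_k_on.simps unfolding smooth_on_def by metis+

lemma open_space_M: "open (space_M T)"
proof -
  have "space_M T = {0<..} \<times> {0<..<T} \<times> UNIV"
    by (auto simp: space_M_def)
  thus ?thesis by (simp add: open_Times)
qed

section \<open>Partial derivatives and the prolongation coefficients in terms of them\<close>

definition dS :: "(point \<Rightarrow> real) \<Rightarrow> point \<Rightarrow> real" where "dS F p = frechet_derivative F (at p) (1, 0, 0)"
definition dt :: "(point \<Rightarrow> real) \<Rightarrow> point \<Rightarrow> real" where "dt F p = frechet_derivative F (at p) (0, 1, 0)"
definition du :: "(point \<Rightarrow> real) \<Rightarrow> point \<Rightarrow> real" where "du F p = frechet_derivative F (at p) (0, 0, 1)"

lemma smooth_partials: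
  assumes "smooth_on F (space_M T)"
  shows "smooth_on (dS F) (space_M T)" "smooth_on (dt F) (space_M T)" "smooth_on (du F) (space_M T)"
  unfolding dS_def[abs_def] dt_def[abs_def] du_def[abs_def] by (rule smooth_onD(3)[OF assms])+

lemma frechet_derivative_partials:
  assumes "F differentiable (at p)"
  shows "frechet_derivative F (at p) (x, y, z) = x * dS F p + y * dt F p + z * du F p"
proof -
  interpret linear "frechet_derivative F (at p)"
    using assms by (rule linear_frechet_derivative)
  have "(x, y, z) = x *\<^sub>R (1, 0, 0) + y *\<^sub>R (0, 1, 0) + z *\<^sub>R (0, 0, 1 :: real)" by simp
  thus ?thesis unfolding dS_def dt_def du_def by (simp only: add scale) simp
qed

lemma has_derivative_partials:
  assumes "smooth_on F (space_M T)" "p \<in> space_M T"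
  shows "(F has_derivative (\<lambda>(x, y, z). x * dS F p + y * dt F p + z * du F p)) (at p)"
proof -
  have "(F has_derivative frechet_derivative F (at p)) (at p)"
    by (rule iffD1[OF frechet_derivative_works smooth_onD(2)[OF assms]])
  moreover have "frechet_derivative F (at p) = (\<lambda>(x, y, z). x * dS F p + y * dt F p + z * du F p)"
    using frechet_derivative_partials[OF smooth_onD(2)[OF assms]] by auto
  ultimately show ?thesis by simp
qed

lemma DS0_eq:
  assumes "smooth_on F (space_M T)" "(S, t, u) \<in> space_M T"
  shows "DS0 F (S, t, u, p, v) = dS F (S, t, u) + p * du F (S, t, u)"
  unfolding DS0_def using frechet_derivative_partials[OF smooth_onD(2)[OF assms]] by simp

lemma Dt0_eq:
  assumes "smooth_on F (space_M T)" "(S, t, u) \<in> space_M T"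
  shows "Dt0 F (S, t, u, p, v) = dt F (S, t, u) + v * du F (S, t, u)"
  unfolding Dt0_def using frechet_derivative_partials[OF smooth_onD(2)[OF assms]] by simp

text \<open>The second total derivative D_S D_S F. The mixed partials \<open>du (dS F)\<close> and
  \<open>dS (du F)\<close> appear as two separate terms.\<close>

definition DSS :: "(point \<Rightarrow> real) \<Rightarrow> jet2 \<Rightarrow> real" where
  "DSS F = (\<lambda>(S, t, u, p, v, q, r, z). let x = (S, t, u) in
     dS (dS F) x + p * du (dS F) x + q * du F x + p * (dS (du F) x + p * du (du F) x))"

text \<open>A derivative is produced, and not only its value in the direction used by
  \<open>DS1\<close>, because \<open>phi_S\<close> multiplies such functions by u_S and u_t and is
  then differentiated by the product rule.\<close>

lemma DS0_has_derivative:
  assumes F: "smooth_on F (space_M T)" and x: "(S, t, u) \<in> space_M T"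
  shows "\<exists>D. (DS0 F has_derivative D) (at (S, t, u, p, v)) \<and> D (1, 0, p, q, r) = DSS F (S, t, u, p, v, q, r, z)"
proof -
  \<comment> \<open>The explicit formula for \<open>DS0 F\<close> is available only over
    \<open>space_M T\<close>, so the derivative is transferred on the open preimage of that
    set.\<close>
  let ?U = "{w :: jet1. (fst w, fst (snd w), fst (snd (snd w))) \<in> space_M T}"
  have U: "open ?U"
    using open_vimage[OF open_space_M[of T], of "\<lambda>w::jet1. (fst w, fst (snd w), fst (snd (snd w)))"]
    by (simp add: vimage_def continuous_intros)
  let ?pt = "\<lambda>w::jet1. (fst w, fst (snd w), fst (snd (snd w)))"
  have comp: "((\<lambda>w::jet1. G (?pt w)) has_derivative
      (\<lambda>w. fst w * dS G (S, t, u) + fst (snd w) * dt G (S, t, u) + fst (snd (snd w)) * du G (S, t, u)))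
      (at (S, t, u, p, v))" if G: "smooth_on G (space_M T)" for G
  proof -
    have "(?pt has_derivative ?pt) (at (S, t, u, p, v))"
      by (auto intro!: derivative_eq_intros)
    from has_derivative_compose[OF this, of G
        "\<lambda>(x, y, z). x * dS G (S, t, u) + y * dt G (S, t, u) + z * du G (S, t, u)"]
      has_derivative_partials[OF G x]
    show ?thesis by simp
  qed
  let ?D = "\<lambda>w::jet1. fst w * dS (dS F) (S, t, u) + fst (snd w) * dt (dS F) (S, t, u) + fst (snd (snd w)) * du (dS F) (S, t, u)
     + (p * (fst w * dS (du F) (S, t, u) + fst (snd w) * dt (du F) (S, t, u) + fst (snd (snd w)) * du (du F) (S, t, u))
      + fst (snd (snd (snd w))) * du F (S, t, u))"
  have "((\<lambda>w. dS F (?pt w) + fst (snd (snd (snd w))) * du F (?pt w)) has_derivative ?D) (at (S, t, u, p, v))"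
    by (rule derivative_eq_intros comp smooth_partials F refl | simp)+
  hence "(DS0 F has_derivative ?D) (at (S, t, u, p, v))"
  proof (rule has_derivative_transform_within_open[OF _ U])
    show "(S, t, u, p, v) \<in> ?U" using x by simp
    show "dS F (?pt w) + fst (snd (snd (snd w))) * du F (?pt w) = DS0 F w" if "w \<in> ?U" for w
      using DS0_eq[OF F] that by (cases w) auto
  qed
  moreover have "?D (1, 0, p, q, r) = DSS F (S, t, u, p, v, q, r, z)"
    by (simp add: DSS_def Let_def algebra_simps)
  ultimately show ?thesis by blast
qed

lemma smooth_coeffs:
  assumes "V \<in> smooth_vfields T"
  shows "smooth_on (xi_coeff V) (space_M T)" "smooth_on (tau_coeff V) (space_M T)" "smooth_on (phi_coeff V) (space_M T)"
proof -
  have V: "C_k_on n V (space_M T)" for n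
    using assms by (simp add: smooth_vfields_def smooth_on_def)
  note c = C_k_on_bounded_linear_comp[OF open_space_M _ V]
  note b = bounded_linear_fst bounded_linear_snd
    bounded_linear_compose[OF bounded_linear_fst bounded_linear_snd]
    bounded_linear_compose[OF bounded_linear_snd bounded_linear_snd]
  show "smooth_on (xi_coeff V) (space_M T)" "smooth_on (tau_coeff V) (space_M T)" "smooth_on (phi_coeff V) (space_M T)"
    unfolding smooth_on_def xi_coeff_def[abs_def] tau_coeff_def[abs_def] phi_coeff_def[abs_def]
    using c[OF b(1)] c[OF b(3)] c[OF b(4)] by auto
qed

lemma phi_t_eq:
  assumes V: "V \<in> smooth_vfields T" and x: "(S, t, u) \<in> space_M T"
  shows "phi_t V (S, t, u, p, v) = dt (phi_coeff V) (S, t, u) + v * du (phi_coeff V) (S, t, u)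
     - p * (dt (xi_coeff V) (S, t, u) + v * du (xi_coeff V) (S, t, u))
     - v * (dt (tau_coeff V) (S, t, u) + v * du (tau_coeff V) (S, t, u))"
  unfolding phi_t_def by (simp add: Dt0_eq[OF smooth_coeffs(1)[OF V] x] Dt0_eq[OF smooth_coeffs(2)[OF V] x]
     Dt0_eq[OF smooth_coeffs(3)[OF V] x])

text \<open>The product rule for \<open>phi_S\<close> differentiates the factors u_S and u_t as
  well. The resulting terms repeat those subtracted in the recursion, whence the factors 2.\<close>

lemma phi_SS_eq:
  assumes V: "V \<in> smooth_vfields T" and x: "(S, t, u) \<in> space_M T"
  shows "phi_SS V (S, t, u, p, v, q, r, z) =
     DSS (phi_coeff V) (S, t, u, p, v, q, r, z) - p * DSS (xi_coeff V) (S, t, u, p, v, q, r, z)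
     - v * DSS (tau_coeff V) (S, t, u, p, v, q, r, z)
     - 2 * q * (dS (xi_coeff V) (S, t, u) + p * du (xi_coeff V) (S, t, u))
     - 2 * r * (dS (tau_coeff V) (S, t, u) + p * du (tau_coeff V) (S, t, u))"
proof -
  let ?w = "(S, t, u, p, v)" let ?W = "(S, t, u, p, v, q, r, z)"
  note sm = smooth_coeffs[OF V]
  obtain D1 D2 D3 where D: "(DS0 (xi_coeff V) has_derivative D1) (at ?w)" "D1 (1, 0, p, q, r) = DSS (xi_coeff V) ?W"
    "(DS0 (tau_coeff V) has_derivative D2) (at ?w)" "D2 (1, 0, p, q, r) = DSS (tau_coeff V) ?W"
    "(DS0 (phi_coeff V) has_derivative D3) (at ?w)" "D3 (1, 0, p, q, r) = DSS (phi_coeff V) ?W"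
    using DS0_has_derivative[OF sm(1) x] DS0_has_derivative[OF sm(2) x] DS0_has_derivative[OF sm(3) x] by metis
  let ?D = "\<lambda>h. D3 h - (p * D1 h + fst (snd (snd (snd h))) * DS0 (xi_coeff V) ?w)
        - (v * D2 h + snd (snd (snd (snd h))) * DS0 (tau_coeff V) ?w)"
  have "((\<lambda>w. DS0 (phi_coeff V) w - fst (snd (snd (snd w))) * DS0 (xi_coeff V) w
       - snd (snd (snd (snd w))) * DS0 (tau_coeff V) w) has_derivative ?D) (at ?w)"
    by (rule derivative_eq_intros D refl | simp)+
  moreover have "phi_S V = (\<lambda>w. DS0 (phi_coeff V) w - fst (snd (snd (snd w))) * DS0 (xi_coeff V) w
       - snd (snd (snd (snd w))) * DS0 (tau_coeff V) w)"
    by (auto simp: phi_S_def Let_def)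
  ultimately have "(phi_S V has_derivative ?D) (at ?w)" by simp
  hence "frechet_derivative (phi_S V) (at ?w) = ?D" by (rule frechet_derivative_at[symmetric])
  thus ?thesis
    unfolding phi_SS_def DS1_def
    by (simp add: D DS0_eq[OF sm(1) x] DS0_eq[OF sm(2) x] algebra_simps)
qed

lemma Delta_has_derivative:
  assumes lam: "(lam has_real_derivative l) (at S)" and nz: "1 - \<rho> * S * lam S * q \<noteq> 0"
  shows "(Delta \<sigma> \<rho> lam has_derivative (\<lambda>(hS, ht, hu, hp, hv, hq, hr, hz).
     hv + (\<sigma>\<^sup>2 * S * q / (1 - \<rho> * S * lam S * q)\<^sup>2 +
          \<sigma>\<^sup>2 * S\<^sup>2 * q\<^sup>2 * (\<rho> * (lam S + S * l)) / (1 - \<rho> * S * lam S * q) ^ 3) * hS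
      + (\<sigma>\<^sup>2 * S\<^sup>2 / 2 * (1 + \<rho> * S * lam S * q) / (1 - \<rho> * S * lam S * q) ^ 3) * hq)) (at (S, t, u, p, v, q, r, z))"
proof -
  let ?w = "(S, t, u, p, v, q, r, z)" and ?q = "\<lambda>w::jet2. fst (snd (snd (snd (snd (snd w)))))"
  define d where "d = 1 - \<rho> * S * lam S * q"
  have d: "d \<noteq> 0" using nz by (simp add: d_def)
  have lam': "((\<lambda>w::jet2. lam (fst w)) has_derivative (\<lambda>h. l * fst h)) (at ?w)"
    using has_derivative_compose[of fst fst ?w UNIV lam "(*) l"] lam
    by (simp add: has_field_derivative_def has_derivative_fst)
  have N: "((\<lambda>w::jet2. 1 - \<rho> * fst w * lam (fst w) * ?q w) has_derivative
     (\<lambda>h. - (\<rho> * (lam S + S * l) * q * fst h + \<rho> * S * lam S * ?q h))) (at ?w)"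
    by (rule derivative_eq_intros lam' refl | simp)+ (simp add: fun_eq_iff algebra_simps)
  have "((\<lambda>x. inverse (x\<^sup>2)) has_real_derivative - (2 / d ^ 3)) (at d)"
    using d by (auto intro!: derivative_eq_intros simp: field_simps power2_eq_square power3_eq_cube)
  hence I: "((\<lambda>w::jet2. inverse ((1 - \<rho> * fst w * lam (fst w) * ?q w)\<^sup>2)) has_derivative
     (\<lambda>h. - (2 / d ^ 3) * - (\<rho> * (lam S + S * l) * q * fst h + \<rho> * S * lam S * ?q h))) (at ?w)"
    using has_derivative_compose[OF N, of "\<lambda>x. inverse (x\<^sup>2)" "(*) (- (2 / d ^ 3))"]
    by (simp add: has_field_derivative_def d_def)
  have Q: "((\<lambda>w::jet2. (\<sigma>\<^sup>2 / 2) * ((fst w)\<^sup>2 * ?q w)) has_derivative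
     (\<lambda>h. (\<sigma>\<^sup>2 / 2) * (2 * S * fst h * q + S\<^sup>2 * ?q h))) (at ?w)"
    by (rule derivative_eq_intros refl | simp)+ (simp add: fun_eq_iff algebra_simps)
  have V: "((\<lambda>w::jet2. fst (snd (snd (snd (snd w))))) has_derivative
     (\<lambda>h. fst (snd (snd (snd (snd h)))))) (at ?w)"
    by (rule derivative_eq_intros refl | simp)+
  define A where "A = \<rho> * (lam S + S * l)"
  define a where "a = \<rho> * S * lam S"
  \<comment> \<open>This identity merges the two contributions to the coefficient of u_SS:
    \<open>d + 2 * (a * q)\<close> becomes \<open>1 + a * q\<close>.\<close>
  have e: "a * q = 1 - d" by (simp add: a_def d_def)
  have D: "Delta \<sigma> \<rho> lam = (\<lambda>w. fst (snd (snd (snd (snd w)))) +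
      (\<sigma>\<^sup>2 / 2) * ((fst w)\<^sup>2 * ?q w) * inverse ((1 - \<rho> * fst w * lam (fst w) * ?q w)\<^sup>2))"
    by (auto simp: Delta_def field_simps)
  have "(\<sigma>\<^sup>2 / 2) * (S\<^sup>2 * q) * (- (2 / d ^ 3) * - (A * q * x + a * y))
       + (\<sigma>\<^sup>2 / 2) * (2 * S * x * q + S\<^sup>2 * y) * inverse (d\<^sup>2)
     = (\<sigma>\<^sup>2 * S * q / d\<^sup>2 + \<sigma>\<^sup>2 * S\<^sup>2 * q\<^sup>2 * A / d ^ 3) * x
       + \<sigma>\<^sup>2 * S\<^sup>2 / 2 * (1 + a * q) / d ^ 3 * y" for x y
  proof -
    have k: "inverse (d\<^sup>2) = d * inverse (d ^ 3)" "c / d ^ 3 = c * inverse (d ^ 3)"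
      "c / d\<^sup>2 = c * (d * inverse (d ^ 3))" for c
      using d by (simp_all add: field_simps power2_eq_square power3_eq_cube)
    have "(\<sigma>\<^sup>2 / 2) * (S\<^sup>2 * q) * (- (2 / d ^ 3) * - (A * q * x + a * y))
       + (\<sigma>\<^sup>2 / 2) * (2 * S * x * q + S\<^sup>2 * y) * inverse (d\<^sup>2)
       = (\<sigma>\<^sup>2 * S * q / d\<^sup>2 + \<sigma>\<^sup>2 * S\<^sup>2 * q\<^sup>2 * A / d ^ 3) * x
       + \<sigma>\<^sup>2 * S\<^sup>2 / 2 * (d + 2 * (a * q)) / d ^ 3 * y"
      by (simp only: k) (simp add: field_simps power2_eq_square[of q] del: power_Suc inverse_eq_divide)
    thus ?thesis by (simp add: e)
  qed
  with has_derivative_add[OF V has_derivative_mult[OF Q I]] show ?thesis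
    unfolding D A_def a_def d_def by (simp add: case_prod_unfold add.assoc)
qed

section \<open>Determining equations\<close>

lemma pr2_apply_Delta:
  assumes V: "V \<in> smooth_vfields T" and x: "(S, t, u) \<in> space_M T"
    and lam: "(lam has_real_derivative l) (at S)" and nz: "1 - \<rho> * S * lam S * q \<noteq> 0"
  shows "pr2_apply V (Delta \<sigma> \<rho> lam) (S, t, u, p, v, q, r, z) =
    phi_t V (S, t, u, p, v)
    + (\<sigma>\<^sup>2 * S * q / (1 - \<rho> * S * lam S * q)\<^sup>2 +
          \<sigma>\<^sup>2 * S\<^sup>2 * q\<^sup>2 * (\<rho> * (lam S + S * l)) / (1 - \<rho> * S * lam S * q) ^ 3) * xi_coeff V (S, t, u)
    + (\<sigma>\<^sup>2 * S\<^sup>2 / 2 * (1 + \<rho> * S * lam S * q) / (1 - \<rho> * S * lam S * q) ^ 3) * phi_SS V (S, t, u, p, v, q, r, z)"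
proof -
  note h = frechet_derivative_at[OF Delta_has_derivative[where \<sigma> = \<sigma> and t = t and u = u and p = p
      and v = v and r = r and z = z, OF lam nz], symmetric]
  show ?thesis unfolding pr2_apply_def h by (simp add: pr2_def Let_def)
qed

lemma partials_eq_0:
  assumes "\<And>x. x \<in> space_M T \<Longrightarrow> F x = c" and x: "x \<in> space_M T"
  shows "dS F x = 0" "dt F x = 0" "du F x = 0"
proof -
  have "frechet_derivative F (at x) = frechet_derivative (\<lambda>_. c) (at x)"
    by (rule frechet_derivative_cong_open[OF open_space_M x assms(1)])
  thus "dS F x = 0" "dt F x = 0" "du F x = 0"
    by (simp_all add: dS_def dt_def du_def)
qed

text \<open>Four distinct nodes determine a cubic; the nodes are 0, 1, -1 and 2.\<close>

lemma cubic_eq_0: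
  fixes e0 e1 e2 e3 :: real
  assumes "\<And>p. e0 + p * e1 + p\<^sup>2 * e2 + p ^ 3 * e3 = 0"
  shows "e0 = 0" "e1 = 0" "e2 = 0" "e3 = 0"
  using assms[of 0] assms[of 1] assms[of "- 1"] assms[of 2] by simp_all

text \<open>Jets with u_t = u_SS = 0 lie on \<open>L_Delta\<close> for every u_St, which enters the
  condition only through the D_S \<tau> term of \<open>phi_SS\<close>. Comparing u_St = 0 with u_St
  = 1 isolates D_S \<tau>, which is affine in u_S.\<close>

lemma symmetry_tau:
  assumes "\<sigma> \<noteq> 0" and V: "V \<in> Diff_Delta T \<sigma> \<rho> lam" and x: "(S, t, u) \<in> space_M T"
    and lam: "(lam has_real_derivative l) (at S)"
  shows "dS (tau_coeff V) (S, t, u) = 0" "du (tau_coeff V) (S, t, u) = 0"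
proof -
  have V': "V \<in> smooth_vfields T" using V by (simp add: Diff_Delta_def)
  have S: "S > 0" using x by (simp add: space_M_def)
  have "phi_t V (S, t, u, p, 0) + \<sigma>\<^sup>2 * S\<^sup>2 / 2 * phi_SS V (S, t, u, p, 0, 0, r, 0) = 0" for p r
  proof -
    have "(S, t, u, p, 0, 0, r, 0) \<in> L_Delta T \<sigma> \<rho> lam"
      using x by (simp add: L_Delta_def Delta_def)
    hence "pr2_apply V (Delta \<sigma> \<rho> lam) (S, t, u, p, 0, 0, r, 0) = 0"
      using V by (simp add: Diff_Delta_def)
    thus ?thesis using pr2_apply_Delta[OF V' x lam, of \<rho> 0] by simp
  qed
  from this[of _ 0] this[of _ 1]
  have "\<sigma>\<^sup>2 * S\<^sup>2 / 2 * phi_SS V (S, t, u, p, 0, 0, 0, 0) = \<sigma>\<^sup>2 * S\<^sup>2 / 2 * phi_SS V (S, t, u, p, 0, 0, 1, 0)" for p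
    by (metis add_left_cancel)
  hence *: "phi_SS V (S, t, u, p, 0, 0, 0, 0) = phi_SS V (S, t, u, p, 0, 0, 1, 0)" for p
    using S assms(1) by simp
  have "dS (tau_coeff V) (S, t, u) + p * du (tau_coeff V) (S, t, u) = 0" for p
    using *[of p] unfolding phi_SS_eq[OF V' x] by (simp add: DSS_def Let_def)
  from this[of 0] this[of 1] show "dS (tau_coeff V) (S, t, u) = 0" "du (tau_coeff V) (S, t, u) = 0"
    by simp_all
qed

text \<open>After elimination of u_t and multiplication by \<open>d ^ 3\<close>, the symmetry
  condition is a cubic polynomial in u_S for each fixed \<open>q\<close>. The three equations are
  its coefficients of degree 0, 1 and 2.\<close>

lemma symmetry_split:
  fixes V :: vfield and T S t u l \<sigma> \<rho> :: real and lam :: "real \<Rightarrow> real"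
  defines "\<xi> \<equiv> xi_coeff V" and "\<tau> \<equiv> tau_coeff V" and "\<phi> \<equiv> phi_coeff V"
    and "x \<equiv> (S, t, u)" and "a \<equiv> \<rho> * S * lam S" and "A \<equiv> \<rho> * (lam S + S * l)" and "c \<equiv> \<sigma>\<^sup>2 * S\<^sup>2 / 2"
  assumes \<sigma>: "\<sigma> \<noteq> 0" and V: "V \<in> Diff_Delta T \<sigma> \<rho> lam" and x: "x \<in> space_M T"
    and diff: "\<forall>S>0. lam differentiable (at S)" and lam: "(lam has_real_derivative l) (at S)"
    and d: "d = 1 - a * q" "d \<noteq> 0"
  shows "dt \<phi> x * d ^ 3 + c * q * d * (dt \<tau> x - du \<phi> x) + (2 * c * q * d / S + 2 * c * q\<^sup>2 * A) * \<xi> x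
      + c * (1 + a * q) * (dS (dS \<phi>) x + q * du \<phi> x - 2 * q * dS \<xi> x) = 0" (is "?e0 = 0")
    and "- dt \<xi> x * d ^ 3 + c * q * d * du \<xi> x
      + c * (1 + a * q) * (du (dS \<phi>) x + dS (du \<phi>) x - dS (dS \<xi>) x - 3 * q * du \<xi> x) = 0" (is "?e1 = 0")
    and "c * (1 + a * q) * (du (du \<phi>) x - du (dS \<xi>) x - dS (du \<xi>) x) = 0" (is "?e2 = 0")
proof -
  have V': "V \<in> smooth_vfields T" using V by (simp add: Diff_Delta_def)
  have S: "S > 0" using x by (simp add: space_M_def x_def)
  \<comment> \<open>This is established at all points and not only at \<open>x\<close>, since the
    second derivatives of \<tau> must vanish too.\<close>
  have tau: "dS \<tau> y = 0" "du \<tau> y = 0" if "y \<in> space_M T" for y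
  proof -
    obtain S' t' u' where y: "y = (S', t', u')" by (cases y)
    have "S' > 0" using that by (simp add: y space_M_def)
    with diff obtain l' where "(lam has_real_derivative l') (at S')"
      using real_differentiable_def by blast
    thus "dS \<tau> y = 0" "du \<tau> y = 0"
      using symmetry_tau[OF \<sigma> V] that unfolding y \<tau>_def by blast+
  qed
  have tau2: "DSS \<tau> (S, t, u, p, v, q, r, z) = 0" for p v r z
    using tau[OF x] partials_eq_0[OF tau(1) x] partials_eq_0[OF tau(2) x]
    by (simp add: DSS_def Let_def x_def[symmetric])
  \<comment> \<open>The value of u_t that puts the jet on \<open>L_Delta\<close>, whatever u_S
    is.\<close>
  define v where "v = - c * q / d\<^sup>2"
  let ?e3 = "- c * (1 + a * q) * du (du \<xi>) x"
  have "?e0 + p * ?e1 + p\<^sup>2 * ?e2 + p ^ 3 * ?e3 = 0" for p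
  proof -
    have "(S, t, u, p, v, q, 0, 0) \<in> L_Delta T \<sigma> \<rho> lam"
      using x d by (simp add: L_Delta_def Delta_def v_def c_def a_def x_def)
    hence "pr2_apply V (Delta \<sigma> \<rho> lam) (S, t, u, p, v, q, 0, 0) = 0"
      using V by (simp add: Diff_Delta_def)
    hence 0: "dt \<phi> x + v * du \<phi> x - p * (dt \<xi> x + v * du \<xi> x) - v * (dt \<tau> x)
     + (\<sigma>\<^sup>2 * S * q / d\<^sup>2 + \<sigma>\<^sup>2 * S\<^sup>2 * q\<^sup>2 * A / d ^ 3) * \<xi> x
     + (c * (1 + a * q) / d ^ 3) * (DSS \<phi> (S, t, u, p, v, q, 0, 0) - p * DSS \<xi> (S, t, u, p, v, q, 0, 0)
         - 2 * q * (dS \<xi> x + p * du \<xi> x)) = 0"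
      using pr2_apply_Delta[OF V' x[unfolded x_def] lam, of \<rho> q \<sigma> p v 0 0] tau[OF x] tau2[of p v 0 0] d
      unfolding phi_t_eq[OF V' x[unfolded x_def]] phi_SS_eq[OF V' x[unfolded x_def]]
      by (simp add: \<xi>_def \<tau>_def \<phi>_def x_def a_def A_def c_def)
    have v: "v * d ^ 3 = - c * q * d"
      using d(2) by (simp add: v_def field_simps power2_eq_square power3_eq_cube)
    have F: "(\<sigma>\<^sup>2 * S * q / d\<^sup>2 + \<sigma>\<^sup>2 * S\<^sup>2 * q\<^sup>2 * A / d ^ 3) * d ^ 3 = 2 * c * q * d / S + 2 * c * q\<^sup>2 * A"
      using d(2) S by (simp add: c_def field_simps power2_eq_square power3_eq_cube)
    have C: "(c * (1 + a * q) / d ^ 3) * d ^ 3 = c * (1 + a * q)" using d(2) by simp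
    have "dt \<phi> x * d ^ 3 + (v * d ^ 3) * du \<phi> x - p * (dt \<xi> x * d ^ 3 + (v * d ^ 3) * du \<xi> x) - (v * d ^ 3) * dt \<tau> x
     + ((\<sigma>\<^sup>2 * S * q / d\<^sup>2 + \<sigma>\<^sup>2 * S\<^sup>2 * q\<^sup>2 * A / d ^ 3) * d ^ 3) * \<xi> x
     + ((c * (1 + a * q) / d ^ 3) * d ^ 3) * (DSS \<phi> (S, t, u, p, v, q, 0, 0) - p * DSS \<xi> (S, t, u, p, v, q, 0, 0)
         - 2 * q * (dS \<xi> x + p * du \<xi> x)) = 0"
      using arg_cong[OF 0, of "\<lambda>y. y * d ^ 3"] by (simp only: algebra_simps mult_zero_left)
    thus ?thesis
      unfolding v F C DSS_def Let_def x_def[symmetric] prod.case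
      by (simp add: algebra_simps power2_eq_square power3_eq_cube)
  qed
  from cubic_eq_0[OF this] show "?e0 = 0" "?e1 = 0" "?e2 = 0" by auto
qed

text \<open>The coordinate \<open>q\<close> is free apart from \<open>1 - a * q \<noteq> 0\<close>.
  Setting \<open>q = 0\<close> gives the second, third and fourth equations; other values of
  \<open>q\<close> give the rest. For \<open>a = 0\<close> the denominator is 1 and less can be
  separated, so the last three conclusions are conditional.\<close>

lemma determining_equations:
  fixes V :: vfield and T S t u l \<sigma> \<rho> :: real and lam :: "real \<Rightarrow> real"
  defines "\<xi> \<equiv> xi_coeff V" and "\<tau> \<equiv> tau_coeff V" and "\<phi> \<equiv> phi_coeff V"
    and "x \<equiv> (S, t, u)" and "a \<equiv> \<rho> * S * lam S" and "A \<equiv> \<rho> * (lam S + S * l)" and "c \<equiv> \<sigma>\<^sup>2 * S\<^sup>2 / 2"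
  assumes \<sigma>: "\<sigma> \<noteq> 0" and V: "V \<in> Diff_Delta T \<sigma> \<rho> lam" and x: "x \<in> space_M T"
    and diff: "\<forall>S>0. lam differentiable (at S)" and lam: "(lam has_real_derivative l) (at S)"
  shows "du \<xi> x = 0" and "du (du \<phi>) x = du (dS \<xi>) x + dS (du \<xi>) x"
    and "dt \<xi> x = c * (du (dS \<phi>) x + dS (du \<phi>) x - dS (dS \<xi>) x)"
    and "dt \<phi> x + c * dS (dS \<phi>) x = 0"
    and "dt \<tau> x = 2 * dS \<xi> x - 2 * \<xi> x / S"
    and "a \<noteq> 0 \<Longrightarrow> dt \<xi> x = 0" and "a \<noteq> 0 \<Longrightarrow> dt \<phi> x = 0"
    and "a \<noteq> 0 \<Longrightarrow> a * (du \<phi> x - 2 * dS \<xi> x) + A * \<xi> x = 0"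
proof -
  have S: "S > 0" using x by (simp add: space_M_def x_def)
  have c: "c \<noteq> 0" using S \<sigma> by (simp add: c_def)
  note E = symmetry_split[OF \<sigma> V x[unfolded x_def] diff lam refl,
      folded \<xi>_def \<tau>_def \<phi>_def x_def a_def A_def c_def]
  show 2: "du (du \<phi>) x = du (dS \<xi>) x + dS (du \<xi>) x" using E(3)[of 0] c by simp
  define K where "K = du (dS \<phi>) x + dS (du \<phi>) x - dS (dS \<xi>) x"
  show 3: "dt \<xi> x = c * (du (dS \<phi>) x + dS (du \<phi>) x - dS (dS \<xi>) x)" using E(2)[of 0] by simp
  show 4: "dt \<phi> x + c * dS (dS \<phi>) x = 0" using E(1)[of 0] by simp
  define f where "f = dt \<phi> x / c"
  have f: "dt \<phi> x = c * f" "dS (dS \<phi>) x = - f" using 4 c by (simp_all add: f_def field_simps)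
  define X where "X = \<xi> x / S"
  have "dt \<xi> x = 0 \<and> du \<xi> x = 0 \<and> f = 0 \<and> dt \<tau> x = 2 * dS \<xi> x - 2 * X \<and>
    a * (du \<phi> x - 2 * dS \<xi> x) + A * \<xi> x = 0" if a: "a \<noteq> 0"
  proof -
    \<comment> \<open>In the variable \<open>s = a * q\<close> the conditions become polynomials in
      \<open>s\<close> with only \<open>s = 1\<close> excluded. These quantities absorb the powers
      of \<open>a\<close> and serve as unknowns.\<close>
    define y where "y = du \<xi> x / a"
    define B where "B = (dt \<tau> x - du \<phi> x + 2 * X) / a"
    define C where "C = (du \<phi> x - 2 * dS \<xi> x) / a"
    define D where "D = 2 * A * \<xi> x / a\<^sup>2"
    define g where "g = K"
    have g: "dt \<xi> x = c * g" using 3 by (simp add: g_def K_def)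
    have e1: "g * ((1 + s) - (1 - s) ^ 3) + y * (s * (1 - s) - 3 * s * (1 + s)) = 0"
      and e0: "f * ((1 - s) ^ 3 - (1 + s)) + s * (1 - s) * B + s\<^sup>2 * D + s * (1 + s) * C = 0"
      if s: "s \<noteq> 1" for s
    proof -
      define q where "q = s / a"
      have q: "a * q = s" using a by (simp add: q_def)
      have nz: "1 - a * q \<noteq> 0" using s q by simp
      have "c * (g * ((1 + s) - (1 - s) ^ 3) + (q * du \<xi> x) * ((1 - s) - 3 * (1 + s))) = 0"
        using E(2)[OF nz] unfolding q g K_def[symmetric, folded g_def] by (simp add: algebra_simps)
      hence "g * ((1 + s) - (1 - s) ^ 3) + (q * du \<xi> x) * ((1 - s) - 3 * (1 + s)) = 0" using c by simp
      moreover have "q * du \<xi> x = s * y" by (simp add: q_def y_def)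
      ultimately show "g * ((1 + s) - (1 - s) ^ 3) + y * (s * (1 - s) - 3 * s * (1 + s)) = 0"
        by (simp add: algebra_simps)
      have "c * (f * ((1 - s) ^ 3 - (1 + s)) + (1 - s) * (q * (dt \<tau> x - du \<phi> x + 2 * X)) + q\<^sup>2 * (2 * A * \<xi> x)
         + (1 + s) * (q * (du \<phi> x - 2 * dS \<xi> x))) = 0"
        using E(1)[OF nz] unfolding q f by (simp add: algebra_simps X_def)
      hence "f * ((1 - s) ^ 3 - (1 + s)) + (1 - s) * (q * (dt \<tau> x - du \<phi> x + 2 * X)) + q\<^sup>2 * (2 * A * \<xi> x)
         + (1 + s) * (q * (du \<phi> x - 2 * dS \<xi> x)) = 0" using c by simp
      moreover have eqs: "q * (dt \<tau> x - du \<phi> x + 2 * X) = s * B" "q * (du \<phi> x - 2 * dS \<xi> x) = s * C"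
         "q\<^sup>2 * (2 * A * \<xi> x) = s\<^sup>2 * D"
        by (simp_all add: q_def B_def C_def D_def power_divide)
      ultimately show "f * ((1 - s) ^ 3 - (1 + s)) + s * (1 - s) * B + s\<^sup>2 * D + s * (1 + s) * C = 0"
        unfolding eqs by (simp add: algebra_simps)
    qed
    \<comment> \<open>Two values of \<open>s\<close> force \<open>g\<close> and \<open>y\<close> to
      vanish. Three values leave a one-parameter family for \<open>f\<close>, \<open>B\<close>,
      \<open>C\<close>, \<open>D\<close>, described by \<open>C\<close>.\<close>
    have gy: "g = 0" "y = 0" using e1[of "- 1"] e1[of 2] by (simp_all add: power3_eq_cube)
    have fBCD: "f = 0" "B = - C" "D = - 2 * C"
      using e0[of "- 1"] e0[of 2] e0[of 3] by (simp_all add: power3_eq_cube)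
    have "dt \<tau> x - du \<phi> x + 2 * X = - (du \<phi> x - 2 * dS \<xi> x)"
      using fBCD(2) a unfolding B_def C_def minus_divide_left divide_cancel_right by simp
    moreover have "A * \<xi> x = - (a * (du \<phi> x - 2 * dS \<xi> x))"
    proof -
      have "2 * A * \<xi> x = D * a\<^sup>2" "a * (du \<phi> x - 2 * dS \<xi> x) = C * a\<^sup>2"
        using a by (simp_all add: D_def C_def power2_eq_square)
      thus ?thesis using fBCD(3) by simp
    qed
    ultimately show ?thesis using gy fBCD a by (simp add: g y_def)
  qed
  moreover have "du \<xi> x = 0 \<and> dt \<tau> x = 2 * dS \<xi> x - 2 * X" if a: "a = 0"
  proof -
    have "c * du \<xi> x = 0"
      using E(2)[of 1] 3 a by (simp add: algebra_simps)
    \<comment> \<open>The values at \<open>q = 1\<close> and, next, at \<open>q = - 1\<close>; their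
      difference cancels the term with \<open>A\<close>.\<close>
    moreover have "c * (f + (dt \<tau> x - du \<phi> x) + (2 * X + 2 * A * \<xi> x) + (- f + du \<phi> x - 2 * dS \<xi> x)) = 0"
      using E(1)[of 1] a unfolding f by (simp add: algebra_simps X_def)
    moreover have "c * (f - (dt \<tau> x - du \<phi> x) + (- 2 * X + 2 * A * \<xi> x) + (- f - du \<phi> x + 2 * dS \<xi> x)) = 0"
      using E(1)[of "- 1"] a unfolding f by (simp add: algebra_simps X_def)
    ultimately show ?thesis using c by auto
  qed
  ultimately show "du \<xi> x = 0" "dt \<tau> x = 2 * dS \<xi> x - 2 * \<xi> x / S"
    "a \<noteq> 0 \<Longrightarrow> dt \<xi> x = 0" "a \<noteq> 0 \<Longrightarrow> dt \<phi> x = 0"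
    "a \<noteq> 0 \<Longrightarrow> a * (du \<phi> x - 2 * dS \<xi> x) + A * \<xi> x = 0"
    by (auto simp: f X_def)
qed

section \<open>Integration of the determining equations\<close>

lemma DERIV_zero_imp_eq:
  fixes f :: "real \<Rightarrow> real"
  assumes "convex I" "\<And>x. x \<in> I \<Longrightarrow> (f has_real_derivative 0) (at x)" "x \<in> I" "y \<in> I"
  shows "f x = f y"
proof -
  have "\<exists>c. \<forall>x\<in>I. f x = c"
    by (rule has_field_derivative_zero_constant[OF assms(1) has_field_derivative_at_within[OF assms(2)]])
  thus ?thesis using assms(3,4) by metis
qed

lemma partials_has_real_derivative:
  assumes F: "smooth_on F (space_M T)" and x: "(S, t, u) \<in> space_M T"
  shows "((\<lambda>s. F (s, t, u)) has_real_derivative dS F (S, t, u)) (at S)"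
    and "((\<lambda>y. F (S, y, u)) has_real_derivative dt F (S, t, u)) (at t)"
    and "((\<lambda>y. F (S, t, y)) has_real_derivative du F (S, t, u)) (at u)"
proof -
  let ?D = "\<lambda>(x, y, z). x * dS F (S, t, u) + y * dt F (S, t, u) + z * du F (S, t, u)"
  note D = has_derivative_partials[OF F x]
  have "((\<lambda>s. (s, t, u)) has_derivative (\<lambda>h. (h, 0, 0))) (at S)"
    "((\<lambda>y. (S, y, u)) has_derivative (\<lambda>h. (0, h, 0))) (at t)"
    "((\<lambda>y. (S, t, y)) has_derivative (\<lambda>h. (0, 0, h))) (at u)"
    by (intro has_derivative_Pair has_derivative_ident has_derivative_const)+
  from has_derivative_compose[OF this(1), of F ?D] has_derivative_compose[OF this(2), of F ?D]
    has_derivative_compose[OF this(3), of F ?D] D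
  show "((\<lambda>s. F (s, t, u)) has_real_derivative dS F (S, t, u)) (at S)"
    "((\<lambda>y. F (S, y, u)) has_real_derivative dt F (S, t, u)) (at t)"
    "((\<lambda>y. F (S, t, y)) has_real_derivative du F (S, t, u)) (at u)"
    by (simp_all add: has_field_derivative_def mult.commute[of _ "_ F _"] fun_eq_iff)
qed

lemma constant_along_partials:
  assumes F: "smooth_on F (space_M T)"
  shows "\<lbrakk>0 < t; t < T; 0 < S; 0 < S'; \<And>s. 0 < s \<Longrightarrow> dS F (s, t, u) = 0\<rbrakk> \<Longrightarrow> F (S, t, u) = F (S', t, u)"
    and "\<lbrakk>0 < S; 0 < t; t < T; 0 < t'; t' < T; \<And>y. 0 < y \<Longrightarrow> y < T \<Longrightarrow> dt F (S, y, u) = 0\<rbrakk> \<Longrightarrow> F (S, t, u) = F (S, t', u)"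
    and "\<lbrakk>0 < S; 0 < t; t < T; \<And>y. du F (S, t, y) = 0\<rbrakk> \<Longrightarrow> F (S, t, u) = F (S, t, u')"
proof -
  note d = partials_has_real_derivative[OF F]
  have M: "(S, t, u) \<in> space_M T \<longleftrightarrow> 0 < S \<and> 0 < t \<and> t < T" for S t u
    by (simp add: space_M_def)
  show "F (S, t, u) = F (S', t, u)"
    if "0 < t" "t < T" "0 < S" "0 < S'" "\<And>s. 0 < s \<Longrightarrow> dS F (s, t, u) = 0"
    using DERIV_zero_imp_eq[of "{0<..}" "\<lambda>s. F (s, t, u)" S S'] d(1)[of _ t u] that by (simp add: M)
  show "F (S, t, u) = F (S, t', u)"
    if "0 < S" "0 < t" "t < T" "0 < t'" "t' < T" "\<And>y. 0 < y \<Longrightarrow> y < T \<Longrightarrow> dt F (S, y, u) = 0"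
    using DERIV_zero_imp_eq[of "{0<..<T}" "\<lambda>y. F (S, y, u)" t t'] d(2)[of S _ u] that by (simp add: M)
  show "F (S, t, u) = F (S, t, u')"
    if "0 < S" "0 < t" "t < T" "\<And>y. du F (S, t, y) = 0"
    using DERIV_zero_imp_eq[of UNIV "\<lambda>y. F (S, t, y)" u u'] d(3)[of S t] that by (simp add: M)
qed

text \<open>This is how identities are differentiated below: each side comes with its own derivative
  formula, and agreement on an open set equates the two.\<close>

lemma has_real_derivative_cong_open:
  fixes f g :: "real \<Rightarrow> real"
  assumes "open U" "x \<in> U" "\<And>y. y \<in> U \<Longrightarrow> f y = g y"
    and "(f has_real_derivative D) (at x)" "(g has_real_derivative E) (at x)"
  shows "D = E"
  using has_field_derivative_transform_within_open[OF assms(4,1,2,3)] assms(5) DERIV_unique by blast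

text \<open>A normal form for all symmetries. Here \<alpha> and \<gamma> are independent parameters;
  the relation between them is imposed later by \<open>lam\<close>.\<close>

definition affine_vfield :: "real \<Rightarrow> real \<Rightarrow> real \<Rightarrow> real \<Rightarrow> real \<Rightarrow> real \<Rightarrow> vfield" where
  "affine_vfield T \<alpha> \<beta> \<gamma> \<delta> \<epsilon> = on_M T (\<lambda>(S, t, u). (\<alpha> * S, \<beta>, \<gamma> * u + \<delta> * S + \<epsilon>))"

theorem symmetry_is_affine:
  assumes \<sigma>: "\<sigma> \<noteq> 0" and \<rho>: "\<rho> \<noteq> 0" and T: "T > 0" and diff: "\<forall>S>0. lam differentiable (at S)"
    and V: "V \<in> Diff_Delta T \<sigma> \<rho> lam" and S0: "S0 > 0" "lam S0 \<noteq> 0"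
  obtains \<alpha> \<beta> \<gamma> \<delta> \<epsilon> where "V = affine_vfield T \<alpha> \<beta> \<gamma> \<delta> \<epsilon>"
    "\<And>S l. S > 0 \<Longrightarrow> lam S \<noteq> 0 \<Longrightarrow> (lam has_real_derivative l) (at S) \<Longrightarrow> \<alpha> * S * l = (\<alpha> - \<gamma>) * lam S"
proof -
  have V': "V \<in> smooth_vfields T" using V by (simp add: Diff_Delta_def)
  define \<xi> where "\<xi> = xi_coeff V"
  define \<tau> where "\<tau> = tau_coeff V"
  define \<phi> where "\<phi> = phi_coeff V"
  have M: "(S, t, u) \<in> space_M T \<longleftrightarrow> 0 < S \<and> 0 < t \<and> t < T" for S t u
    by (simp add: space_M_def)
  note sm = smooth_coeffs[OF V', folded \<xi>_def \<tau>_def \<phi>_def]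
  have "\<exists>l. (lam has_real_derivative l) (at S)" if "S > 0" for S
    using diff that real_differentiable_def by blast
  then obtain L where L: "\<And>S. S > 0 \<Longrightarrow> (lam has_real_derivative L S) (at S)" by metis
  note deq = determining_equations[OF \<sigma> V _ diff L, folded \<xi>_def \<tau>_def \<phi>_def]
  note ddS = partials_has_real_derivative(1) and ddt = partials_has_real_derivative(2)
    and ddu = partials_has_real_derivative(3)

  \<comment> \<open>On a whole neighbourhood \<open>J0\<close> of \<open>S0\<close> the equations
    conditional on \<open>a \<noteq> 0\<close> are available, for all \<open>t\<close> and
    \<open>u\<close>.\<close>
  have "isCont lam S0" using L[OF S0(1)] DERIV_isCont by blast
  hence "eventually (\<lambda>S. lam S \<noteq> 0) (nhds S0)"
    using S0(2) tendsto_imp_eventually_ne[of lam "lam S0" "at S0" 0] by (simp add: isCont_def eventually_nhds_conv_at)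
  then obtain J0' where J0': "open J0'" "S0 \<in> J0'" "\<And>S. S \<in> J0' \<Longrightarrow> lam S \<noteq> 0"
    unfolding eventually_nhds by blast
  define J0 where "J0 = J0' \<inter> {0<..}"
  have J0: "open J0" "S0 \<in> J0" "\<And>S. S \<in> J0 \<Longrightarrow> lam S \<noteq> 0 \<and> 0 < S"
    using J0' S0 by (auto simp: J0_def)

  have tau_eq: "\<tau> (S, t, u) = \<tau> (S', t, u')" if "0 < S" "0 < S'" "0 < t" "t < T" for S S' t u u'
  proof -
    have t0: "dS \<tau> (S, t, u) = 0" "du \<tau> (S, t, u) = 0" if "0 < S" for S u
      using symmetry_tau[OF \<sigma> V _ L, of S t u] that \<open>0 < t\<close> \<open>t < T\<close> by (simp_all add: M \<tau>_def)
    have "\<tau> (S, t, u) = \<tau> (S', t, u)"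
      using that t0 by (intro constant_along_partials(1)[OF sm(2)])
    also have "\<dots> = \<tau> (S', t, u')"
      using that t0 by (intro constant_along_partials(3)[OF sm(2)])
    finally show ?thesis .
  qed
  have xi_u: "\<xi> (S, t, u) = \<xi> (S, t, u')" if "0 < S" "0 < t" "t < T" for S t u u'
    using that deq(1)[of S t] by (intro constant_along_partials(3)[OF sm(1)]) (simp_all add: M)
  have dxi_u: "dS \<xi> (S, t, u) = dS \<xi> (S, t, u')" if "0 < S" "0 < t" "t < T" for S t u u'
    by (rule has_real_derivative_cong_open[of "{0<..}" S, OF _ _ _ ddS[OF sm(1)] ddS[OF sm(1)]])
      (use that M xi_u in auto)
  \<comment> \<open>As \<open>du \<xi>\<close> vanishes, so do both mixed partials of \<xi>, and
    \<phi> is affine in \<open>u\<close>; its slope is called \<open>G\<close> below.\<close>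
  have phi_uu: "du (du \<phi>) (S, t, u) = 0" if "0 < S" "0 < t" "t < T" for S t u
  proof -
    have "dS (du \<xi>) (S, t, u) = 0"
      using partials_eq_0(1)[of T "du \<xi>" 0 "(S, t, u)"] deq(1) that M by auto
    moreover have "du (dS \<xi>) (S, t, u) = 0"
      by (rule has_real_derivative_cong_open[of UNIV u, OF _ _ _ ddu[OF smooth_partials(1)[OF sm(1)]] DERIV_const])
        (use that M dxi_u in auto)
    ultimately show ?thesis using deq(2)[of S t u] that M by auto
  qed
  define G where "G S t = du \<phi> (S, t, 0)" for S t
  have G: "du \<phi> (S, t, u) = G S t" if "0 < S" "0 < t" "t < T" for S t u
    unfolding G_def
    using that phi_uu by (intro constant_along_partials(3)[OF smooth_partials(3)[OF sm(3)]])
  have phi: "\<phi> (S, t, u) = G S t * u + \<phi> (S, t, 0)" if "0 < S" "0 < t" "t < T" for S t u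
  proof -
    have "\<phi> (S, t, u) - G S t * u = \<phi> (S, t, 0) - G S t * 0"
    proof (rule DERIV_zero_imp_eq[of UNIV "\<lambda>y. \<phi> (S, t, y) - G S t * y"])
      show "((\<lambda>y. \<phi> (S, t, y) - G S t * y) has_real_derivative 0) (at y)" for y
        using DERIV_diff[OF ddu[OF sm(3), of S t y] DERIV_cmult_Id[of "G S t"]] G[of S t y] that by (simp add: M)
    qed auto
    thus ?thesis by simp
  qed
  define GS where "GS S t = dS (du \<phi>) (S, t, 0)" for S t
  have dG: "((\<lambda>s. G s t) has_real_derivative GS S t) (at S)" if "0 < S" "0 < t" "t < T" for S t
    unfolding G_def GS_def using ddS[OF smooth_partials(3)[OF sm(3)]] that M by blast
  have phi_S: "dS \<phi> (S, t, u) = GS S t * u + dS \<phi> (S, t, 0)" if "0 < S" "0 < t" "t < T" for S t u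
    by (rule has_real_derivative_cong_open[of "{0<..}" S, OF _ _ _ ddS[OF sm(3)]
          DERIV_add[OF DERIV_cmult_right[OF dG] ddS[OF sm(3)]]])
      (use that M phi[of _ t u] in auto)
  have phi_uS: "du (dS \<phi>) (S, t, u) = GS S t" if "0 < S" "0 < t" "t < T" for S t u
    by (rule has_real_derivative_cong_open[OF open_UNIV UNIV_I phi_S[OF that] ddu[OF smooth_partials(1)[OF sm(3)]]])
      (use that M in \<open>auto intro!: derivative_eq_intros\<close>)
  have phi_Su: "dS (du \<phi>) (S, t, u) = GS S t" if "0 < S" "0 < t" "t < T" for S t u
    by (rule has_real_derivative_cong_open[of "{0<..}" S, OF _ _ _ ddS[OF smooth_partials(3)[OF sm(3)]] dG])
      (use that M G in auto)

  \<comment> \<open>Let \<open>b\<close> be the value of \<tau>_t at time \<open>t\<close>. The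
    equation \<xi>_S = \<xi>/S + b/2 gives \<xi>_SS = b/(2S). On \<open>J0\<close> also \<xi>_t = 0,
    so the third equation yields G_S = b/(4S), while \<phi>_SS = 0 for all \<open>u\<close> makes
    G_S locally constant in \<open>S\<close>. Hence \<open>b = 0\<close>.\<close>
  have tau_t: "dt \<tau> (S, t, u) = 0" if St: "0 < S" "0 < t" "t < T" for S t u
  proof -
    define b where "b = dt \<tau> (S, t, u)"
    have b: "dt \<tau> (s, t, y) = b" if "0 < s" for s y
      unfolding b_def
      by (rule has_real_derivative_cong_open[of "{0<..<T}" t, OF _ _ _ ddt[OF sm(2)] ddt[OF sm(2)]])
        (use that St M tau_eq in auto)
    have xiS: "dS \<xi> (s, t, 0) = \<xi> (s, t, 0) / s + b / 2" if "0 < s" for s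
      using deq(5)[of s t 0] b[of s 0] that St M by (auto simp: diff_divide_distrib)
    have xiSS: "dS (dS \<xi>) (s, t, 0) = b / (2 * s)" if s: "0 < s" for s
    proof -
      have "((\<lambda>s. \<xi> (s, t, 0) / s + b / 2) has_real_derivative
         (dS \<xi> (s, t, 0) * s - \<xi> (s, t, 0) * 1) / (s * s) + 0) (at s)"
        using s St by (intro DERIV_add DERIV_divide ddS[OF sm(1)] DERIV_ident DERIV_const) (auto simp: M)
      moreover have "(dS \<xi> (s, t, 0) * s - \<xi> (s, t, 0) * 1) / (s * s) + 0 = b / (2 * s)"
        using xiS[OF s] s by (simp add: field_simps)
      ultimately have d: "((\<lambda>s. \<xi> (s, t, 0) / s + b / 2) has_real_derivative b / (2 * s)) (at s)"
        by metis
      show ?thesis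
        by (rule has_real_derivative_cong_open[of "{0<..}" s, OF _ _ _ ddS[OF smooth_partials(1)[OF sm(1)]] d])
          (use s St M xiS in auto)
    qed
    have GSJ: "GS s t = b / 4 * inverse s" if s: "s \<in> J0" for s
    proof -
      have s0: "0 < s" "lam s \<noteq> 0" using J0(3)[OF s] by auto
      have "dt \<xi> (s, t, 0) = 0" using deq(6)[of s t 0] s0 St M \<rho> by auto
      hence "2 * GS s t = b / (2 * s)"
        using deq(3)[of s t 0] phi_uS[of s t 0] phi_Su[of s t 0] xiSS[of s] s0 St M \<sigma> by auto
      thus ?thesis using s0 by (simp add: field_simps)
    qed
    have GSS: "dS (dS \<phi>) (s, t, y) = 0" if s: "s \<in> J0" for s y
    proof -
      have s0: "0 < s" "lam s \<noteq> 0" using J0(3)[OF s] by auto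
      have "dt \<phi> (s, t, y) = 0" using deq(7)[of s t y] s0 St M \<rho> by auto
      thus ?thesis using deq(4)[of s t y] s0 St M \<sigma> by auto
    qed
    \<comment> \<open>This difference is \<open>GS s t\<close>. Its derivative at \<open>S0\<close>
      is computed once from \<phi>_SS = 0 and once from the formula with \<open>b\<close>.\<close>
    have "((\<lambda>s. dS \<phi> (s, t, 1) - dS \<phi> (s, t, 0)) has_real_derivative 0 - 0) (at S0)"
      using ddS[OF smooth_partials(1)[OF sm(3)], of S0 t 0] ddS[OF smooth_partials(1)[OF sm(3)], of S0 t 1]
        GSS[OF J0(2), of 0] GSS[OF J0(2), of 1] S0 St M by (intro DERIV_diff) auto
    moreover have "((\<lambda>s. b / 4 * inverse s) has_real_derivative b / 4 * - (inverse S0 ^ Suc (Suc 0))) (at S0)"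
      using S0 by (intro DERIV_cmult DERIV_inverse) auto
    ultimately have "0 - 0 = b / 4 * - (inverse S0 ^ Suc (Suc 0))"
      by (rule has_real_derivative_cong_open[OF J0(1,2), rotated]) (use GSJ phi_S[of _ t 1] J0(3) St in simp)
    thus ?thesis using S0 by (simp add: b_def)
  qed
  define t0 where "t0 = T / 2"
  have t0: "0 < t0" "t0 < T" using T by (auto simp: t0_def)
  define \<beta> where "\<beta> = \<tau> (S0, t0, 0)"
  have tau: "\<tau> (S, t, u) = \<beta>" if "0 < S" "0 < t" "t < T" for S t u
  proof -
    have "\<tau> (S, t, u) = \<tau> (S0, t, 0)" using tau_eq that S0 by blast
    also have "\<dots> = \<beta>" unfolding \<beta>_def
      using that tau_t t0 S0 by (intro constant_along_partials(2)[OF sm(2)])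
    finally show ?thesis .
  qed
  define \<alpha> where "\<alpha> = \<xi> (S0, t0, 0) / S0"
  \<comment> \<open>With \<tau>_t = 0 the fifth equation says that \<xi>/S is constant in
    \<open>S\<close>, even where \<open>lam\<close> vanishes. Independence of \<open>t\<close> is
    known at \<open>S0\<close> and carried along by this constancy.\<close>
  have xi: "\<xi> (S, t, u) = \<alpha> * S" if St: "0 < S" "0 < t" "t < T" for S t u
  proof -
    have "\<xi> (S, t, 0) / S = \<xi> (S0, t, 0) / S0"
    proof (rule DERIV_zero_imp_eq[of "{0<..}" "\<lambda>s. \<xi> (s, t, 0) / s"])
      fix s :: real assume s: "s \<in> {0<..}"
      have "((\<lambda>s. \<xi> (s, t, 0) / s) has_real_derivative
         (dS \<xi> (s, t, 0) * s - \<xi> (s, t, 0) * 1) / (s * s)) (at s)"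
        using s St by (intro DERIV_divide ddS[OF sm(1)] DERIV_ident) (auto simp: M)
      moreover have "dS \<xi> (s, t, 0) * s = \<xi> (s, t, 0)"
        using deq(5)[of s t 0] tau_t[of s t 0] s St M by (auto simp: field_simps)
      ultimately show "((\<lambda>s. \<xi> (s, t, 0) / s) has_real_derivative 0) (at s)" by simp
    qed (use St S0 in auto)
    moreover have "\<xi> (S0, t, 0) = \<xi> (S0, t0, 0)"
      using St deq(6)[of S0 _ 0] \<rho> t0 S0 by (intro constant_along_partials(2)[OF sm(1)]) (simp_all add: M)
    ultimately have "\<xi> (S, t, 0) = \<alpha> * S" using St S0 by (simp add: \<alpha>_def field_simps)
    thus ?thesis using xi_u[OF St, of u 0] by simp
  qed
  have xi_S: "dS \<xi> (S, t, u) = \<alpha>" if St: "0 < S" "0 < t" "t < T" for S t u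
    using deq(5)[of S t u] tau_t[of S t u] xi St M by auto
  \<comment> \<open>The form of \<xi> now makes \<xi>_t and \<xi>_SS vanish everywhere, so the third
    equation gives G_S = 0 also at zeros of \<open>lam\<close>.\<close>
  have GS0: "GS S t = 0" if St: "0 < S" "0 < t" "t < T" for S t
  proof -
    have "dS (dS \<xi>) (S, t, 0) = 0"
      using partials_eq_0(1)[of T "dS \<xi>" \<alpha> "(S, t, 0)"] xi_S St M by auto
    moreover have "dt \<xi> (S, t, 0) = 0"
      by (rule has_real_derivative_cong_open[of "{0<..<T}" t, OF _ _ _ ddt[OF sm(1)] DERIV_const])
        (use xi St M in auto)
    ultimately show ?thesis
      using deq(3)[of S t 0] phi_uS[of S t 0] phi_Su[of S t 0] St M \<sigma> by auto
  qed
  have phiS0: "\<phi> (S, t, u) = \<phi> (S, t0, u)" if "S \<in> J0" "0 < t" "t < T" for S t u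
    using that deq(7)[of S _ u] \<rho> t0 J0(3)[OF that(1)] by (intro constant_along_partials(2)[OF sm(3)]) (simp_all add: M)
  define \<gamma> where "\<gamma> = G S0 t0"
  have G_eq: "G S t = \<gamma>" if St: "0 < S" "0 < t" "t < T" for S t
  proof -
    have "G S t = G S0 t"
      unfolding G_def using GS0 St S0
      by (intro constant_along_partials(1)[OF smooth_partials(3)[OF sm(3)]]) (simp_all add: GS_def)
    \<comment> \<open>At \<open>S0\<close> the slope is the difference of \<phi> at
      \<open>u = 1\<close> and \<open>u = 0\<close>, and both values are independent of
      \<open>t\<close> by \<open>phiS0\<close>.\<close>
    also have "\<dots> = \<gamma>"
      using phi[of S0 t 1] phi[of S0 t0 1] phiS0[OF J0(2) St(2,3), of 0] phiS0[OF J0(2) St(2,3), of 1] S0 St t0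
      by (simp add: \<gamma>_def)
    finally show ?thesis .
  qed
  \<comment> \<open>The line \<open>\<delta> * S + \<epsilon>\<close> is tangent at
    \<open>S0\<close> to the graph of \<phi> at \<open>t = t0\<close>, \<open>u = 0\<close>. Since
    \<phi> does not depend on \<open>t\<close> over \<open>J0\<close>, subtracting it leaves zero
    Cauchy data on the line \<open>S = S0\<close> at all times.\<close>
  define \<delta> where "\<delta> = dS \<phi> (S0, t0, 0)"
  define \<epsilon> where "\<epsilon> = \<phi> (S0, t0, 0) - \<delta> * S0"
  \<comment> \<open>The line solves the linear equation itself, so the difference still satisfies
    \<open>deq(4)\<close>, solved here for \<phi>_SS.\<close>
  have w0: "\<phi> (S, t, 0) - (\<delta> * S + \<epsilon>) = 0" if St: "0 < S" "0 < t" "t < T" for S t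
  proof (rule unique_continuation[of "{0<..}" S0 "{0<..<T}" "\<lambda>s t. \<phi> (s, t, 0) - (\<delta> * s + \<epsilon>)" "\<lambda>s t. dS \<phi> (s, t, 0) - \<delta>"
        "\<lambda>s t. dS (dS \<phi>) (s, t, 0)" "\<lambda>s t. dt \<phi> (s, t, 0)" "\<lambda>s. - 2 / (\<sigma>\<^sup>2 * s\<^sup>2)"])
    fix s t :: real assume st: "s \<in> {0<..}" "t \<in> {0<..<T}"
    show "((\<lambda>s. \<phi> (s, t, 0) - (\<delta> * s + \<epsilon>)) has_real_derivative dS \<phi> (s, t, 0) - \<delta>) (at s)"
      using ddS[OF sm(3), of s t 0] st M by (auto intro!: derivative_eq_intros)
    show "((\<lambda>s. dS \<phi> (s, t, 0) - \<delta>) has_real_derivative dS (dS \<phi>) (s, t, 0)) (at s)"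
      using ddS[OF smooth_partials(1)[OF sm(3)], of s t 0] st M by (auto intro!: derivative_eq_intros)
    show "((\<lambda>t. \<phi> (s, t, 0) - (\<delta> * s + \<epsilon>)) has_real_derivative dt \<phi> (s, t, 0)) (at t)"
      using ddt[OF sm(3), of s t 0] st M by (auto intro!: derivative_eq_intros)
    show "dS (dS \<phi>) (s, t, 0) = - 2 / (\<sigma>\<^sup>2 * s\<^sup>2) * dt \<phi> (s, t, 0)"
      using deq(4)[of s t 0] st M \<sigma> by (auto simp: field_simps)
  next
    fix t assume t: "t \<in> {0<..<T}"
    show "\<phi> (S0, t, 0) - (\<delta> * S0 + \<epsilon>) = 0"
      using phiS0[OF J0(2), of t 0] t by (simp add: \<epsilon>_def)
    have "dS \<phi> (S0, t, 0) = \<delta>" unfolding \<delta>_def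
      by (rule has_real_derivative_cong_open[OF J0(1,2) _ ddS[OF sm(3)] ddS[OF sm(3)]])
        (use phiS0[of _ t 0] t t0 S0 M in auto)
    thus "dS \<phi> (S0, t, 0) - \<delta> = 0" by simp
  next
    have sect: "continuous_on ({0<..} \<times> {0<..<T}) (\<lambda>(s, t). F (s, t, 0))" if "smooth_on F (space_M T)" for F
    proof -
      have "continuous_on ({0<..} \<times> {0<..<T}) (\<lambda>p::real \<times> real. F (fst p, snd p, 0))"
        by (rule continuous_on_compose2[OF smooth_onD(1)[OF that]])
          (auto simp: M intro!: continuous_intros)
      thus ?thesis by (simp add: case_prod_unfold)
    qed
    show "continuous_on ({0<..} \<times> {0<..<T}) (\<lambda>(s, t). \<phi> (s, t, 0) - (\<delta> * s + \<epsilon>))"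
      "continuous_on ({0<..} \<times> {0<..<T}) (\<lambda>(s, t). dS \<phi> (s, t, 0) - \<delta>)"
      using sect[OF sm(3)] sect[OF smooth_partials(1)[OF sm(3)]]
      by (auto simp: case_prod_unfold intro!: continuous_intros)
    show "continuous_on ({0<..} \<times> {0<..<T}) (\<lambda>(s, t). dS (dS \<phi>) (s, t, 0))"
      "continuous_on ({0<..} \<times> {0<..<T}) (\<lambda>(s, t). dt \<phi> (s, t, 0))"
      using sect[OF smooth_partials(1)[OF smooth_partials(1)[OF sm(3)]]] sect[OF smooth_partials(2)[OF sm(3)]]
      by auto
    show "continuous_on {0<..} (\<lambda>s. - 2 / (\<sigma>\<^sup>2 * s\<^sup>2))"
      using \<sigma> by (auto intro!: continuous_intros)
  qed (use St S0 in auto)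
  have "V = affine_vfield T \<alpha> \<beta> \<gamma> \<delta> \<epsilon>"
  proof
    fix p show "V p = affine_vfield T \<alpha> \<beta> \<gamma> \<delta> \<epsilon> p"
    proof (cases "p \<in> space_M T")
      case True
      obtain S t u where p: "p = (S, t, u)" by (cases p)
      have St: "0 < S" "0 < t" "t < T" using True by (auto simp: p M)
      have "V p = (\<xi> p, \<tau> p, \<phi> p)" by (simp add: \<xi>_def \<tau>_def \<phi>_def xi_coeff_def tau_coeff_def phi_coeff_def)
      also have "\<dots> = (\<alpha> * S, \<beta>, \<gamma> * u + \<delta> * S + \<epsilon>)"
        using xi[OF St, of u] tau[OF St, of u] phi[OF St, of u] G_eq[OF St] w0[OF St] by (simp add: p)
      finally show ?thesis using True by (simp add: affine_vfield_def on_M_def p)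
    next
      case False
      moreover from this have "V p = 0" using V' unfolding smooth_vfields_def by blast
      ultimately show ?thesis by (simp add: affine_vfield_def on_M_def)
    qed
  qed
  moreover have "\<alpha> * S * l = (\<alpha> - \<gamma>) * lam S"
    if S: "S > 0" "lam S \<noteq> 0" and l: "(lam has_real_derivative l) (at S)" for S l
  proof -
    have St: "0 < S" "0 < t0" "t0 < T" using S t0 by auto
    have "\<rho> * S * lam S * (\<gamma> - 2 * \<alpha>) + \<rho> * (lam S + S * l) * (\<alpha> * S) = 0"
      using determining_equations(8)[OF \<sigma> V _ diff l, of t0 0, folded \<xi>_def \<phi>_def] \<rho> S
        G[OF St, of 0] G_eq[OF St] xi_S[OF St, of 0] xi[OF St, of 0] t0 M by auto
    hence "(\<rho> * S) * (lam S * (\<gamma> - 2 * \<alpha>) + (lam S + S * l) * \<alpha>) = 0" by (simp add: algebra_simps)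
    hence "lam S * (\<gamma> - 2 * \<alpha>) + (lam S + S * l) * \<alpha> = 0" using \<rho> S by simp
    thus ?thesis by (simp add: algebra_simps)
  qed
  ultimately show thesis using that by blast
qed

section \<open>Affine vector fields\<close>

lemma affine_vfield_smooth: "affine_vfield T \<alpha> \<beta> \<gamma> \<delta> \<epsilon> \<in> smooth_vfields T"
proof -
  have "bounded_linear (\<lambda>p::point. (\<alpha> * fst p, 0::real, \<gamma> * snd (snd p) + \<delta> * fst p))"
    by (intro bounded_linear_Pair bounded_linear_add bounded_linear_zero
        bounded_linear_const_mult bounded_linear_fst bounded_linear_compose[OF bounded_linear_snd bounded_linear_snd])
  hence "smooth_on (affine_vfield T \<alpha> \<beta> \<gamma> \<delta> \<epsilon>) (space_M T)"
    by (rule smooth_on_affine[OF open_space_M, where c = "(0, \<beta>, \<epsilon>)"]) (auto simp: affine_vfield_def on_M_def)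
  thus ?thesis by (simp add: smooth_vfields_def affine_vfield_def on_M_def)
qed

lemma partials_affine:
  assumes "\<And>x. x \<in> space_M T \<Longrightarrow> F x = a * fst x + b * snd (snd x) + c" "x \<in> space_M T"
  shows "dS F x = a" "dt F x = 0" "du F x = b"
proof -
  let ?F = "\<lambda>x::point. a * fst x + b * snd (snd x) + c"
  have "(?F has_derivative (\<lambda>h. a * fst h + b * snd (snd h))) (at x)"
    by (auto intro!: derivative_eq_intros)
  from frechet_derivative_at[OF this] frechet_derivative_cong_open[OF open_space_M assms(2,1)]
  have "frechet_derivative F (at x) = (\<lambda>h. a * fst h + b * snd (snd h))" by simp
  thus "dS F x = a" "dt F x = 0" "du F x = b" by (simp_all add: dS_def dt_def du_def)
qed

text \<open>The prolongation scales u_t by \<gamma> and u_SS by \<gamma> - 2 \<alpha>, so on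
  \<open>L_Delta\<close> the condition collapses to a multiple of Euler's equation
  \<open>rel\<close>.\<close>

lemma affine_vfield_symmetry:
  assumes diff: "\<forall>S>0. lam differentiable (at S)"
    and rel: "\<And>S l. S > 0 \<Longrightarrow> (lam has_real_derivative l) (at S) \<Longrightarrow> \<alpha> * S * l = (\<alpha> - \<gamma>) * lam S"
  shows "affine_vfield T \<alpha> \<beta> \<gamma> \<delta> \<epsilon> \<in> Diff_Delta T \<sigma> \<rho> lam"
proof -
  let ?V = "affine_vfield T \<alpha> \<beta> \<gamma> \<delta> \<epsilon>"
  have xi: "xi_coeff ?V x = \<alpha> * fst x + 0 * snd (snd x) + 0"
    and tau: "tau_coeff ?V x = 0 * fst x + 0 * snd (snd x) + \<beta>"
    and phi: "phi_coeff ?V x = \<delta> * fst x + \<gamma> * snd (snd x) + \<epsilon>" if "x \<in> space_M T" for x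
    using that by (auto simp: xi_coeff_def tau_coeff_def phi_coeff_def affine_vfield_def on_M_def case_prod_unfold)
  note d1 = partials_affine[OF xi] partials_affine[OF tau] partials_affine[OF phi]
  note d2 = partials_eq_0[of T "dS (xi_coeff ?V)", OF d1(1)] partials_eq_0[of T "du (xi_coeff ?V)", OF d1(3)]
    partials_eq_0[of T "dS (tau_coeff ?V)", OF d1(4)] partials_eq_0[of T "du (tau_coeff ?V)", OF d1(6)]
    partials_eq_0[of T "dS (phi_coeff ?V)", OF d1(7)] partials_eq_0[of T "du (phi_coeff ?V)", OF d1(9)]
  have "pr2_apply ?V (Delta \<sigma> \<rho> lam) w = 0" if w: "w \<in> L_Delta T \<sigma> \<rho> lam" for w
  proof -
    obtain S t u p v q r z where w_eq: "w = (S, t, u, p, v, q, r, z)" by (metis prod.collapse)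
    have x: "(S, t, u) \<in> space_M T" and nz: "1 - \<rho> * S * lam S * q \<noteq> 0"
      and v: "v = - (\<sigma>\<^sup>2 * S\<^sup>2 / 2 * (q / (1 - \<rho> * S * lam S * q)\<^sup>2))"
      using w by (auto simp: w_eq L_Delta_def Delta_def)
    have S: "S > 0" using x by (simp add: space_M_def)
    obtain l where l: "(lam has_real_derivative l) (at S)"
      using diff S real_differentiable_def by blast
    have phit: "phi_t ?V (S, t, u, p, v) = \<gamma> * v"
      using phi_t_eq[OF affine_vfield_smooth x, of \<alpha> \<beta> \<gamma> \<delta> \<epsilon> p v] x by (simp add: d1)
    have phiSS: "phi_SS ?V (S, t, u, p, v, q, r, z) = (\<gamma> - 2 * \<alpha>) * q"
      using phi_SS_eq[OF affine_vfield_smooth x, of \<alpha> \<beta> \<gamma> \<delta> \<epsilon> p v q r z] x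
      by (simp add: d1 d2 DSS_def Let_def algebra_simps)
    define d where "d = 1 - \<rho> * S * lam S * q"
    \<comment> \<open>The factor common to all three terms; on \<open>L_Delta\<close> it gives
      \<open>v = - k * d\<close>.\<close>
    define k where "k = \<sigma>\<^sup>2 * S\<^sup>2 * q / (2 * d ^ 3)"
    have d: "d \<noteq> 0" using nz by (simp add: d_def)
    have e: "\<rho> * S * lam S * q = 1 - d" by (simp add: d_def)
    have v': "v = - k * d" using v[folded d_def] d by (simp add: k_def power2_eq_square power3_eq_cube)
    have t1: "(\<sigma>\<^sup>2 * S * q / d\<^sup>2 + \<sigma>\<^sup>2 * S\<^sup>2 * q\<^sup>2 * (\<rho> * (lam S + S * l)) / d ^ 3) * (\<alpha> * S)
       = k * (2 * d * \<alpha> + 2 * q * \<rho> * (lam S + S * l) * \<alpha> * S)"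
      using d by (simp add: k_def field_simps power2_eq_square power3_eq_cube)
    have t2: "(\<sigma>\<^sup>2 * S\<^sup>2 / 2 * (1 + \<rho> * S * lam S * q) / d ^ 3) * ((\<gamma> - 2 * \<alpha>) * q)
       = k * ((1 + \<rho> * S * lam S * q) * (\<gamma> - 2 * \<alpha>))"
      by (simp add: k_def)
    have "pr2_apply ?V (Delta \<sigma> \<rho> lam) w = \<gamma> * (- k * d) +
        k * (2 * d * \<alpha> + 2 * q * \<rho> * (lam S + S * l) * \<alpha> * S)
        + k * ((1 + \<rho> * S * lam S * q) * (\<gamma> - 2 * \<alpha>))"
      unfolding w_eq pr2_apply_Delta[OF affine_vfield_smooth x l nz] phit phiSS v'[symmetric]
        d_def[symmetric] t2 using xi[OF x] t1 by simp
    also have "\<dots> = k * (2 * q * \<rho> * S) * (\<alpha> * S * l - (\<alpha> - \<gamma>) * lam S)"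
      unfolding d_def by (simp add: algebra_simps)
    finally show ?thesis using rel[OF S l] by simp
  qed
  thus ?thesis using affine_vfield_smooth by (simp add: Diff_Delta_def)
qed

section \<open>Spans and independence of the generators\<close>

lemma affine_vfield_add:
  "affine_vfield T \<alpha> \<beta> \<gamma> \<delta> \<epsilon> + affine_vfield T \<alpha>' \<beta>' \<gamma>' \<delta>' \<epsilon>' =
   affine_vfield T (\<alpha> + \<alpha>') (\<beta> + \<beta>') (\<gamma> + \<gamma>') (\<delta> + \<delta>') (\<epsilon> + \<epsilon>')"
  by (auto simp: affine_vfield_def on_M_def fun_eq_iff algebra_simps)

lemma affine_vfield_scaleR:
  "c *\<^sub>R affine_vfield T \<alpha> \<beta> \<gamma> \<delta> \<epsilon> = affine_vfield T (c * \<alpha>) (c * \<beta>) (c * \<gamma>) (c * \<delta>) (c * \<epsilon>)"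
  by (auto simp: affine_vfield_def on_M_def fun_eq_iff scaleR_fun_def algebra_simps)

lemma affine_vfield_zero: "affine_vfield T 0 0 0 0 0 = 0"
  by (auto simp: affine_vfield_def on_M_def fun_eq_iff zero_prod_def)

lemma affine_vfield_eq_0_iff:
  assumes "T > 0"
  shows "affine_vfield T \<alpha> \<beta> \<gamma> \<delta> \<epsilon> = 0 \<longleftrightarrow> \<alpha> = 0 \<and> \<beta> = 0 \<and> \<gamma> = 0 \<and> \<delta> = 0 \<and> \<epsilon> = 0"
proof
  assume 0: "affine_vfield T \<alpha> \<beta> \<gamma> \<delta> \<epsilon> = 0"
  have "(S, T / 2, u) \<in> space_M T" if "S > 0" for S u using assms that by (simp add: space_M_def)
  hence "(\<alpha> * S, \<beta>, \<gamma> * u + \<delta> * S + \<epsilon>) = 0" if "S > 0" for S u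
    using fun_cong[OF 0, of "(S, T / 2, u)"] that by (simp add: affine_vfield_def on_M_def)
  \<comment> \<open>The pairs \<open>(S, u)\<close> equal to \<open>(1, 0)\<close>,
    \<open>(1, 1)\<close> and \<open>(2, 0)\<close> separate the five parameters.\<close>
  from this[of 1 0] this[of 1 1] this[of 2 0]
  show "\<alpha> = 0 \<and> \<beta> = 0 \<and> \<gamma> = 0 \<and> \<delta> = 0 \<and> \<epsilon> = 0" by (simp add: zero_prod_def)
qed (simp add: affine_vfield_zero)

lemma V_eq_affine_vfield:
  "V1 T = affine_vfield T 0 1 0 0 0" "V2 T = affine_vfield T 0 0 0 1 0"
  "V3 T = affine_vfield T 0 0 0 0 1" "V4 T k = affine_vfield T 1 0 (1 - k) 0 0"
  by (auto simp: V1_def V2_def V3_def V4_def affine_vfield_def on_M_def)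

lemma affine_vfield_eq_combination:
  "affine_vfield T \<alpha> \<beta> (\<alpha> * (1 - k)) \<delta> \<epsilon> = \<beta> *\<^sub>R V1 T + \<delta> *\<^sub>R V2 T + \<epsilon> *\<^sub>R V3 T + \<alpha> *\<^sub>R V4 T k"
  by (simp add: V_eq_affine_vfield affine_vfield_add affine_vfield_scaleR)

lemma span_V1_V2_V3_V4:
  "span {V1 T, V2 T, V3 T, V4 T k} = {affine_vfield T \<alpha> \<beta> (\<alpha> * (1 - k)) \<delta> \<epsilon> | \<alpha> \<beta> \<delta> \<epsilon>. True}" (is "_ = ?A")
proof
  \<comment> \<open>The relation for \<gamma> is a side condition here, since sums and multiples do
    not literally have a third parameter of the form \<open>\<alpha> * (1 - k)\<close>.\<close>
  have A: "affine_vfield T \<alpha> \<beta> \<gamma> \<delta> \<epsilon> \<in> ?A" if "\<gamma> = \<alpha> * (1 - k)" for \<alpha> \<beta> \<gamma> \<delta> \<epsilon>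
    using that by blast
  have "V1 T \<in> ?A" "V2 T \<in> ?A" "V3 T \<in> ?A" "V4 T k \<in> ?A"
    unfolding V_eq_affine_vfield by (rule A, simp)+
  moreover have "subspace ?A"
  proof (rule subspaceI)
    show "0 \<in> ?A" unfolding affine_vfield_zero[of T, symmetric] by (rule A) simp
    show "x + y \<in> ?A" if xy: "x \<in> ?A" "y \<in> ?A" for x y
    proof -
      obtain \<alpha> \<beta> \<delta> \<epsilon> \<alpha>' \<beta>' \<delta>' \<epsilon>' where "x = affine_vfield T \<alpha> \<beta> (\<alpha> * (1 - k)) \<delta> \<epsilon>"
        "y = affine_vfield T \<alpha>' \<beta>' (\<alpha>' * (1 - k)) \<delta>' \<epsilon>'"
        using xy by blast
      thus ?thesis by (simp only: affine_vfield_add) (rule A, simp add: algebra_simps)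
    qed
    show "c *\<^sub>R x \<in> ?A" if x: "x \<in> ?A" for c x
    proof -
      obtain \<alpha> \<beta> \<delta> \<epsilon> where "x = affine_vfield T \<alpha> \<beta> (\<alpha> * (1 - k)) \<delta> \<epsilon>"
        using x by blast
      thus ?thesis by (simp only: affine_vfield_scaleR) (rule A, simp)
    qed
  qed
  ultimately show "span {V1 T, V2 T, V3 T, V4 T k} \<subseteq> ?A"
    by (intro span_minimal) auto
  show "?A \<subseteq> span {V1 T, V2 T, V3 T, V4 T k}"
  proof clarify
    fix \<alpha> \<beta> \<delta> \<epsilon>
    show "affine_vfield T \<alpha> \<beta> (\<alpha> * (1 - k)) \<delta> \<epsilon> \<in> span {V1 T, V2 T, V3 T, V4 T k}"
      unfolding affine_vfield_eq_combination by (intro span_add span_scale span_base) simp_all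
  qed
qed

lemma span_V1_V2_V3:
  "span {V1 T, V2 T, V3 T} = {affine_vfield T 0 \<beta> 0 \<delta> \<epsilon> | \<beta> \<delta> \<epsilon>. True}" (is "_ = ?A")
proof
  have A: "affine_vfield T \<alpha> \<beta> \<gamma> \<delta> \<epsilon> \<in> ?A" if "\<alpha> = 0" "\<gamma> = 0" for \<alpha> \<beta> \<gamma> \<delta> \<epsilon>
    using that by blast
  have "V1 T \<in> ?A" "V2 T \<in> ?A" "V3 T \<in> ?A"
    unfolding V_eq_affine_vfield by (rule A; simp)+
  moreover have "subspace ?A"
  proof (rule subspaceI)
    show "0 \<in> ?A" unfolding affine_vfield_zero[of T, symmetric] by (rule A) simp_all
    show "x + y \<in> ?A" if xy: "x \<in> ?A" "y \<in> ?A" for x y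
    proof -
      obtain \<beta> \<delta> \<epsilon> \<beta>' \<delta>' \<epsilon>' where "x = affine_vfield T 0 \<beta> 0 \<delta> \<epsilon>" "y = affine_vfield T 0 \<beta>' 0 \<delta>' \<epsilon>'"
        using xy by blast
      thus ?thesis by (simp only: affine_vfield_add) (rule A; simp)
    qed
    show "c *\<^sub>R x \<in> ?A" if x: "x \<in> ?A" for c x
    proof -
      obtain \<beta> \<delta> \<epsilon> where "x = affine_vfield T 0 \<beta> 0 \<delta> \<epsilon>"
        using x by blast
      thus ?thesis by (simp only: affine_vfield_scaleR) (rule A; simp)
    qed
  qed
  ultimately show "span {V1 T, V2 T, V3 T} \<subseteq> ?A"
    by (intro span_minimal) auto
  have "affine_vfield T 0 \<beta> 0 \<delta> \<epsilon> = \<beta> *\<^sub>R V1 T + \<delta> *\<^sub>R V2 T + \<epsilon> *\<^sub>R V3 T" for \<beta> \<delta> \<epsilon>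
    using affine_vfield_eq_combination[of T 0 \<beta> 0 \<delta> \<epsilon>] by simp
  moreover have "\<beta> *\<^sub>R V1 T + \<delta> *\<^sub>R V2 T + \<epsilon> *\<^sub>R V3 T \<in> span {V1 T, V2 T, V3 T}" for \<beta> \<delta> \<epsilon>
    by (intro span_add span_scale span_base) simp_all
  ultimately show "?A \<subseteq> span {V1 T, V2 T, V3 T}" by auto
qed

lemma
  assumes "T > 0"
  shows independent_V1_V2_V3_V4: "independent {V1 T, V2 T, V3 T, V4 T k}"
    and card_V1_V2_V3_V4: "card {V1 T, V2 T, V3 T, V4 T k} = 4"
    and card_V1_V2_V3: "card {V1 T, V2 T, V3 T} = 3"
proof -
  have ne: "V \<noteq> W" if "V - W \<noteq> 0" for V W :: vfield using that by auto
  have diff: "affine_vfield T \<alpha> \<beta> \<gamma> \<delta> \<epsilon> - affine_vfield T \<alpha>' \<beta>' \<gamma>' \<delta>' \<epsilon>' =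
    affine_vfield T (\<alpha> - \<alpha>') (\<beta> - \<beta>') (\<gamma> - \<gamma>') (\<delta> - \<delta>') (\<epsilon> - \<epsilon>')" for \<alpha> \<beta> \<gamma> \<delta> \<epsilon> \<alpha>' \<beta>' \<gamma>' \<delta>' \<epsilon>'
    by (auto simp: affine_vfield_def on_M_def fun_eq_iff algebra_simps)
  \<comment> \<open>Distinctness fixes the cardinalities and lets the sum over the set in the
    independence proof be expanded term by term.\<close>
  have d: "V1 T \<noteq> V2 T" "V1 T \<noteq> V3 T" "V1 T \<noteq> V4 T k" "V2 T \<noteq> V3 T" "V2 T \<noteq> V4 T k" "V3 T \<noteq> V4 T k"
    by (rule ne, simp add: V_eq_affine_vfield diff affine_vfield_eq_0_iff[OF assms])+
  thus "card {V1 T, V2 T, V3 T, V4 T k} = 4" "card {V1 T, V2 T, V3 T} = 3" by simp_all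
  show "independent {V1 T, V2 T, V3 T, V4 T k}"
  proof
    assume "dependent {V1 T, V2 T, V3 T, V4 T k}"
    then obtain f where f: "\<exists>v\<in>{V1 T, V2 T, V3 T, V4 T k}. f v \<noteq> 0"
      "(\<Sum>v\<in>{V1 T, V2 T, V3 T, V4 T k}. f v *\<^sub>R v) = 0"
      by (auto simp: real_vector.dependent_finite)
    have "affine_vfield T (f (V4 T k)) (f (V1 T)) (f (V4 T k) * (1 - k)) (f (V2 T)) (f (V3 T)) = 0"
      using f(2) d unfolding affine_vfield_eq_combination by (simp add: add.assoc)
    thus False using f(1) by (simp add: affine_vfield_eq_0_iff[OF assms])
  qed
qed

section \<open>Closure under the Lie bracket\<close>

text \<open>The derivative of an affine field is its linear part, so the bracket is affine again. It
  is a combination of \<open>V2\<close> and \<open>V3\<close>, which both spans contain.\<close>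

lemma lie_bracket_affine_vfield:
  "lie_bracket T (affine_vfield T \<alpha> \<beta> \<gamma> \<delta> \<epsilon>) (affine_vfield T \<alpha>' \<beta>' \<gamma>' \<delta>' \<epsilon>') =
   affine_vfield T 0 0 0 (\<delta>' * \<alpha> + \<gamma>' * \<delta> - \<delta> * \<alpha>' - \<gamma> * \<delta>') (\<gamma>' * \<epsilon> - \<gamma> * \<epsilon>')"
proof -
  have der: "frechet_derivative (affine_vfield T \<alpha> \<beta> \<gamma> \<delta> \<epsilon>) (at p) =
      (\<lambda>h. (\<alpha> * fst h, 0, \<gamma> * snd (snd h) + \<delta> * fst h))" if p: "p \<in> space_M T" for p \<alpha> \<beta> \<gamma> \<delta> \<epsilon>
  proof -
    have "frechet_derivative (affine_vfield T \<alpha> \<beta> \<gamma> \<delta> \<epsilon>) (at p) =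
       frechet_derivative (\<lambda>x. (\<alpha> * fst x, \<beta>, \<gamma> * snd (snd x) + \<delta> * fst x + \<epsilon>)) (at p)"
      by (rule frechet_derivative_cong_open[OF open_space_M p]) (auto simp: affine_vfield_def on_M_def)
    also have "\<dots> = (\<lambda>h. (\<alpha> * fst h, 0, \<gamma> * snd (snd h) + \<delta> * fst h))"
      by (rule frechet_derivative_at[symmetric]) (auto intro!: derivative_eq_intros has_derivative_Pair)
    finally show ?thesis .
  qed
  have val: "affine_vfield T \<alpha> \<beta> \<gamma> \<delta> \<epsilon> p = (if p \<in> space_M T then
     (\<alpha> * fst p, \<beta>, \<gamma> * snd (snd p) + \<delta> * fst p + \<epsilon>) else 0)" for p \<alpha> \<beta> \<gamma> \<delta> \<epsilon>
    by (simp add: affine_vfield_def on_M_def case_prod_unfold)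
  show ?thesis
    unfolding lie_bracket_def by (rule ext) (simp add: on_M_def der val algebra_simps)
qed

lemma lie_algebra_span_V1_V2_V3: "lie_algebra_vfields T (span {V1 T, V2 T, V3 T})"
  unfolding lie_algebra_vfields_def
proof (intro conjI ballI)
  show "lie_bracket T V W \<in> span {V1 T, V2 T, V3 T}"
    if VW: "V \<in> span {V1 T, V2 T, V3 T}" "W \<in> span {V1 T, V2 T, V3 T}" for V W
  proof -
    obtain \<beta> \<delta> \<epsilon> \<beta>' \<delta>' \<epsilon>' where "V = affine_vfield T 0 \<beta> 0 \<delta> \<epsilon>" "W = affine_vfield T 0 \<beta>' 0 \<delta>' \<epsilon>'"
      using VW unfolding span_V1_V2_V3 by blast
    hence "lie_bracket T V W = affine_vfield T 0 0 0 (\<delta>' * 0 + 0 * \<delta> - \<delta> * 0 - 0 * \<delta>') (0 * \<epsilon> - 0 * \<epsilon>')"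
      by (simp only: lie_bracket_affine_vfield)
    thus ?thesis unfolding span_V1_V2_V3 by blast
  qed
  show "span {V1 T, V2 T, V3 T} \<subseteq> smooth_vfields T"
    unfolding span_V1_V2_V3 using affine_vfield_smooth by blast
qed (rule subspace_span)

lemma lie_algebra_span_V1_V2_V3_V4: "lie_algebra_vfields T (span {V1 T, V2 T, V3 T, V4 T k})"
  unfolding lie_algebra_vfields_def
proof (intro conjI ballI)
  show "lie_bracket T V W \<in> span {V1 T, V2 T, V3 T, V4 T k}"
    if VW: "V \<in> span {V1 T, V2 T, V3 T, V4 T k}" "W \<in> span {V1 T, V2 T, V3 T, V4 T k}" for V W
  proof -
    have A: "affine_vfield T 0 0 0 \<delta> \<epsilon> \<in> span {V1 T, V2 T, V3 T, V4 T k}" for \<delta> \<epsilon>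
    proof -
      have "affine_vfield T 0 0 (0 * (1 - k)) \<delta> \<epsilon> \<in> span {V1 T, V2 T, V3 T, V4 T k}"
        unfolding span_V1_V2_V3_V4 by blast
      thus ?thesis by (simp only: mult_zero_left)
    qed
    obtain \<alpha> \<beta> \<delta> \<epsilon> \<alpha>' \<beta>' \<delta>' \<epsilon>' where "V = affine_vfield T \<alpha> \<beta> (\<alpha> * (1 - k)) \<delta> \<epsilon>"
        "W = affine_vfield T \<alpha>' \<beta>' (\<alpha>' * (1 - k)) \<delta>' \<epsilon>'"
      using VW unfolding span_V1_V2_V3_V4 by blast
    hence "lie_bracket T V W = affine_vfield T 0 0 0 (\<delta>' * \<alpha> + \<alpha>' * (1 - k) * \<delta> - \<delta> * \<alpha>' - \<alpha> * (1 - k) * \<delta>')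
        (\<alpha>' * (1 - k) * \<epsilon> - \<alpha> * (1 - k) * \<epsilon>')"
      by (simp only: lie_bracket_affine_vfield)
    with A show ?thesis by metis
  qed
  show "span {V1 T, V2 T, V3 T, V4 T k} \<subseteq> smooth_vfields T"
    unfolding span_V1_V2_V3_V4 using affine_vfield_smooth by blast
qed (rule subspace_span)

section \<open>Euler's equation and powers of S\<close>

text \<open>With the integrating factor \<open>S powr (- k)\<close>, Euler's equation says that
  \<open>f\<close> has derivative 0 wherever \<open>lam\<close> is nonzero; hence \<open>f\<close>
  times its derivative vanishes for all \<open>S > 0\<close>.\<close>

lemma power_form_if_euler:
  assumes diff: "\<forall>S>0. lam differentiable (at S)" and S0: "S0 > 0" "lam S0 \<noteq> 0"
    and rel: "\<And>S l. S > 0 \<Longrightarrow> lam S \<noteq> 0 \<Longrightarrow> (lam has_real_derivative l) (at S) \<Longrightarrow> S * l = k * lam S"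
  shows "\<exists>\<omega>. power_form lam \<omega> k"
proof -
  define f where "f S = lam S * S powr (- k)" for S
  have f: "\<exists>D. (f has_real_derivative D) (at S) \<and> f S * D = 0" if S: "S > 0" for S
  proof -
    obtain l where l: "(lam has_real_derivative l) (at S)"
      using diff S real_differentiable_def by blast
    have "(f has_real_derivative l * S powr (- k) + (- k * S powr (- k - 1)) * lam S) (at S)"
      unfolding f_def[abs_def] by (intro DERIV_mult l has_real_derivative_powr S)
    moreover have "S powr (- k) = S * S powr (- k - 1)" using S by (simp add: powr_diff)
    ultimately have "(f has_real_derivative S powr (- k - 1) * (S * l - k * lam S)) (at S)"
      by (simp add: algebra_simps)
    moreover have "f S * (S powr (- k - 1) * (S * l - k * lam S)) = 0"
      using rel[OF S _ l] by (auto simp: f_def)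
    ultimately show ?thesis by blast
  qed
  \<comment> \<open>Passing through \<open>f\<^sup>2\<close> excludes zeros of \<open>lam\<close>, at which \<open>rel\<close> says nothing.\<close>
  have "(f S)\<^sup>2 = (f S0)\<^sup>2" if "S > 0" for S
  proof (rule DERIV_zero_imp_eq[of "{0<..}" "\<lambda>S. (f S)\<^sup>2"])
    fix x :: real assume "x \<in> {0<..}"
    then obtain D where "(f has_real_derivative D) (at x)" "f x * D = 0" using f by auto
    thus "((\<lambda>S. (f S)\<^sup>2) has_real_derivative 0) (at x)"
      by (auto intro!: derivative_eq_intros)
  qed (use that S0 in auto)
  moreover have "f S0 \<noteq> 0" using S0 by (simp add: f_def)
  ultimately have nz: "f S \<noteq> 0" if "S > 0" for S using that by fastforce
  have "f S = f S0" if "S > 0" for S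
  proof (rule DERIV_zero_imp_eq[of "{0<..}" f])
    fix x :: real assume "x \<in> {0<..}"
    thus "(f has_real_derivative 0) (at x)" using f[of x] nz[of x] by auto
  qed (use that S0 in auto)
  hence "lam S = f S0 * S powr k" if "S > 0" for S
    using that by (auto simp: f_def powr_minus field_simps)
  thus ?thesis using \<open>f S0 \<noteq> 0\<close> by (auto simp: power_form_def)
qed

lemma power_form_deriv:
  assumes "power_form lam \<omega> k" "S > 0" "(lam has_real_derivative l) (at S)"
  shows "S * l = k * lam S"
proof -
  have lam: "\<And>S. S > 0 \<Longrightarrow> lam S = \<omega> * S powr k" using assms(1) by (simp add: power_form_def)
  have "((\<lambda>S. \<omega> * S powr k) has_real_derivative \<omega> * (k * S powr (k - 1))) (at S)"
    by (intro DERIV_cmult has_real_derivative_powr assms(2))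
  hence "l = \<omega> * (k * S powr (k - 1))"
    using has_real_derivative_cong_open[of "{0<..}" S lam] lam assms(2,3) by auto
  thus ?thesis using lam[OF assms(2)] assms(2) by (simp add: powr_diff)
qed

section \<open>The classification of the symmetry algebras\<close>

text \<open>The zero function is kept out of the generic case: for it the equation is linear and
  \<open>affine_vfield T 0 0 1 0 0\<close>, the scaling of \<open>u\<close>, is a symmetry outside
  both spans. The generic case is settled by excluding \<alpha> \<noteq> 0, the power case by
  determining \<gamma> from \<alpha>.\<close>

theorem theorem2p1:
  fixes \<sigma> \<rho> T :: real and lam :: "real \<Rightarrow> real"
  assumes "\<sigma> \<noteq> 0" and "\<rho> \<noteq> 0" and "T > 0"
    and "\<forall>S>0. lam differentiable (at S)"
  shows
    "(lie_algebra_vfields T (span {V1 T, V2 T, V3 T}) \<and>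
      dim (span {V1 T, V2 T, V3 T}) = 3 \<and>
      span {V1 T, V2 T, V3 T} \<subseteq> Diff_Delta T \<sigma> \<rho> lam) \<and>
     ((\<exists>S>0. lam S \<noteq> 0) \<and> (\<nexists>\<omega> k. power_form lam \<omega> k) \<longrightarrow>
        lie_algebra_vfields T (Diff_Delta T \<sigma> \<rho> lam) \<and>
        dim (Diff_Delta T \<sigma> \<rho> lam) = 3 \<and>
        Diff_Delta T \<sigma> \<rho> lam = span {V1 T, V2 T, V3 T}) \<and>
     (\<forall>\<omega> k. power_form lam \<omega> k \<longrightarrow>
        lie_algebra_vfields T (Diff_Delta T \<sigma> \<rho> lam) \<and>
        dim (Diff_Delta T \<sigma> \<rho> lam) = 4 \<and>
        Diff_Delta T \<sigma> \<rho> lam = span {V1 T, V2 T, V3 T, V4 T k})"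
proof -
  have "independent {V1 T, V2 T, V3 T}"
    using independent_V1_V2_V3_V4[OF assms(3), of 0] by (rule real_vector.independent_mono) auto
  hence dim3: "dim (span {V1 T, V2 T, V3 T}) = 3"
    using card_V1_V2_V3[OF assms(3)] dim_span_eq_card_independent by metis
  have dim4: "dim (span {V1 T, V2 T, V3 T, V4 T k}) = 4" for k
    using independent_V1_V2_V3_V4[OF assms(3)] card_V1_V2_V3_V4[OF assms(3)]
      dim_span_eq_card_independent by metis
  have sub3: "span {V1 T, V2 T, V3 T} \<subseteq> Diff_Delta T \<sigma> \<rho> lam"
    unfolding span_V1_V2_V3 using affine_vfield_symmetry[OF assms(4)] by auto
  have eq3: "Diff_Delta T \<sigma> \<rho> lam = span {V1 T, V2 T, V3 T}"
    if S0: "S0 > 0" "lam S0 \<noteq> 0" and np: "\<nexists>\<omega> k. power_form lam \<omega> k" for S0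
  proof
    show "Diff_Delta T \<sigma> \<rho> lam \<subseteq> span {V1 T, V2 T, V3 T}"
    proof
      fix V assume "V \<in> Diff_Delta T \<sigma> \<rho> lam"
      then obtain \<alpha> \<beta> \<gamma> \<delta> \<epsilon> where V: "V = affine_vfield T \<alpha> \<beta> \<gamma> \<delta> \<epsilon>"
        and rel: "\<And>S l. S > 0 \<Longrightarrow> lam S \<noteq> 0 \<Longrightarrow> (lam has_real_derivative l) (at S) \<Longrightarrow> \<alpha> * S * l = (\<alpha> - \<gamma>) * lam S"
        using symmetry_is_affine[OF assms _ S0] by metis
      \<comment> \<open>Otherwise \<open>rel\<close> is Euler's equation with exponent
        \<open>(\<alpha> - \<gamma>) / \<alpha>\<close>, and \<open>lam\<close> would be a
        power.\<close>
      have "\<alpha> = 0"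
      proof (rule ccontr)
        assume "\<alpha> \<noteq> 0"
        hence "S * l = (\<alpha> - \<gamma>) / \<alpha> * lam S"
          if "S > 0" "lam S \<noteq> 0" "(lam has_real_derivative l) (at S)" for S l
          using rel[OF that] by (simp add: field_simps)
        with np show False using power_form_if_euler[OF assms(4) S0] by blast
      qed
      moreover obtain l where "(lam has_real_derivative l) (at S0)"
        using assms(4) S0 real_differentiable_def by blast
      ultimately have "\<gamma> = 0" using rel[OF S0] S0 by auto
      with \<open>\<alpha> = 0\<close> V show "V \<in> span {V1 T, V2 T, V3 T}" unfolding span_V1_V2_V3 by blast
    qed
  qed (rule sub3)
  have eq4: "Diff_Delta T \<sigma> \<rho> lam = span {V1 T, V2 T, V3 T, V4 T k}" if pf: "power_form lam \<omega> k" for \<omega> k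
  proof
    \<comment> \<open>At \<open>S = 1\<close> a power form takes the value \<omega> whatever
      \<open>k\<close> is, so 1 serves as the point where \<open>lam\<close> is nonzero.\<close>
    have lam1: "lam 1 \<noteq> 0" using pf by (simp add: power_form_def)
    obtain l1 where l1: "(lam has_real_derivative l1) (at 1)"
      using assms(4) real_differentiable_def zero_less_one by blast
    show "Diff_Delta T \<sigma> \<rho> lam \<subseteq> span {V1 T, V2 T, V3 T, V4 T k}"
    proof
      fix V assume "V \<in> Diff_Delta T \<sigma> \<rho> lam"
      then obtain \<alpha> \<beta> \<gamma> \<delta> \<epsilon> where V: "V = affine_vfield T \<alpha> \<beta> \<gamma> \<delta> \<epsilon>"
        and rel: "\<And>S l. S > 0 \<Longrightarrow> lam S \<noteq> 0 \<Longrightarrow> (lam has_real_derivative l) (at S) \<Longrightarrow> \<alpha> * S * l = (\<alpha> - \<gamma>) * lam S"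
        using symmetry_is_affine[OF assms _ zero_less_one lam1] by metis
      have "\<alpha> * (k * lam 1) = (\<alpha> - \<gamma>) * lam 1"
        using rel[OF zero_less_one lam1 l1] power_form_deriv[OF pf zero_less_one l1] by simp
      hence "(\<gamma> - \<alpha> * (1 - k)) * lam 1 = 0" by (simp add: algebra_simps)
      hence "\<gamma> = \<alpha> * (1 - k)" using lam1 by simp
      with V show "V \<in> span {V1 T, V2 T, V3 T, V4 T k}" unfolding span_V1_V2_V3_V4 by blast
    qed
    have "affine_vfield T \<alpha> \<beta> (\<alpha> * (1 - k)) \<delta> \<epsilon> \<in> Diff_Delta T \<sigma> \<rho> lam" for \<alpha> \<beta> \<delta> \<epsilon>
      using power_form_deriv[OF pf]
      by (intro affine_vfield_symmetry[OF assms(4)]) (simp add: mult.assoc algebra_simps)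
    thus "span {V1 T, V2 T, V3 T, V4 T k} \<subseteq> Diff_Delta T \<sigma> \<rho> lam"
      unfolding span_V1_V2_V3_V4 by blast
  qed
  show ?thesis
    using lie_algebra_span_V1_V2_V3 lie_algebra_span_V1_V2_V3_V4 dim3 dim4 sub3 eq3 eq4 by auto
qed

end
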